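(* (1) Let $q$ be a prime power. For every integer $$d>-1+\sqrt{3\left(q^2+1-\sqrt[q+1]{\binom{q^2}{q}(q-1)!}\right)}$$ there is a homogeneous polynomial $f\in\mathbb{F}_q[x,y,z,w]$ of degree $d$, not divisible by $\varphi$, such that the inversive curve $C_f\subset\mathcal{O}$ is circle-transverse-free. (2) Let $q$ be an even prime power. For every integer $$d>-3+\sqrt{12q^2-12q+1-24\sqrt[q/2]{\binom{q(q-1)/2}{q/2}\frac{(q/2)!}{q^2-1}}}$$ there is an $xw$-symmetric homogeneous polynomial $f\in\mathbb{F}_q[x,y,z,w]$ of degree $d$, not divisible by $\varphi$, such that the hyperbolic curve $C_f\subset\mathcal{O}$ is line-transverse-free.
   Context: Fix $\gamma\in\mathbb{F}_q$ with $t^2+t+\gamma$ irreducible over $\mathbb{F}_q$, let $\varphi=xw-y^2-yz-\gamma z^2$, and let $\mathcal{O}=\{\varphi=0\}\subset\mathbb{P}^3$ (points over $\overline{\mathbb{F}_q}$), a smooth quadric surface. For a homogeneous $f\in\mathbb{F}_q[x,y,z,w]$, $S_f=\{f=0\}\subset\mathbb{P}^3$ and $C_f=S_f\cap\mathcal{O}$ (an inversive curve). The tangent space $T_PS_f$ at $P\in S_f$ is the plane with coefficient vector $\nabla f(P)$ if $\nabla f(P)\neq0$, and $\mathbb{P}^3$ otherwise; $T_P\mathcal{O}$ is the tangent plane of $\mathcal{O}$. For $P\in C_f$, $T_PC_f:=T_PS_f\cap T_P\mathcal{O}$ (a line if $C_f$ is smooth at $P$, i.e. $T_P\mathcal O\not\subset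 T_PS_f$; equal to $T_P\mathcal{O}$ otherwise). A circle is $C_\ell=S_\ell\cap\mathcal{O}$ where $\ell$ is a nonzero linear form over $\mathbb{F}_q$ whose plane is not tangent to $\mathcal{O}$. The circle $C_\ell$ is tangent to $C_f$ if there is a point $P\in C_\ell\cap C_f$ (over $\overline{\mathbb{F}_q}$) with $T_PC_\ell\subset T_PC_f$. $C_f$ is circle-transverse-free if every circle is tangent to it. A polynomial $f$ is $xw$-symmetric if $f(x,y,z,w)=f(w,y,z,x)$. For $q$ even, a hyperbolic curve is $C_f$ with $f$ $xw$-symmetric. Let $B=C_{x+w}$ (base circle). A hyperbolic line is a circle $C_\ell\ne B$ with $\ell$ $xw$-symmetric. A hyperbolic curve $C_f$ is line-transverse-free if every hyperbolic line $C_\ell$ is tangent to it, i.e. for every hyperbolic line $C_\ell$ there is a point $P\in C_\ell\cap C_f$ (over $\overline{\mathbb{F}_q}$) with $T_PC_\ell\subset T_PC_f$. *)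

theory Defs
  imports
    "HOL-Analysis.Analysis"
    "HOL-Algebra.Algebraic_Closure_Type"
    "HOL-Library.Poly_Mapping"
begin

subsection \<open>Polynomials in four variables\<close>

text \<open>
  The variables \<open>x, y, z, w\<close> are indexed by \<open>1, 2, 3, 4 :: 4\<close>; a polynomial maps exponent vectors
  to coefficients, and multiplication is the convolution product of \<open>Poly_Mapping\<close>.
\<close>

type_synonym 'a pol = "(4 \<Rightarrow>\<^sub>0 nat) \<Rightarrow>\<^sub>0 'a"

definition Const :: "'a::zero \<Rightarrow> 'a pol" where
  "Const c = Poly_Mapping.single 0 c"

definition Var :: "4 \<Rightarrow> 'a::zero_neq_one pol" where
  "Var i = Poly_Mapping.single (Poly_Mapping.single i 1) 1"

text \<open>Substitution of \<open>v i\<close> for the \<open>i\<close>-th variable, with \<open>h\<close> applied to the coefficients.\<close>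

definition subst_pol :: "('a::zero \<Rightarrow> 'b::comm_semiring_1) \<Rightarrow> (4 \<Rightarrow> 'b) \<Rightarrow> 'a pol \<Rightarrow> 'b" where
  "subst_pol h v f =
     (\<Sum>m\<in>Poly_Mapping.keys f.
        h (Poly_Mapping.lookup f m) * (\<Prod>i\<in>UNIV. v i ^ Poly_Mapping.lookup m i))"

definition partial_deriv :: "4 \<Rightarrow> 'a::comm_semiring_1 pol \<Rightarrow> 'a pol" where
  "partial_deriv i f =
     (\<Sum>m\<in>Poly_Mapping.keys f.
        Poly_Mapping.single (m - Poly_Mapping.single i 1)
          (of_nat (Poly_Mapping.lookup m i) * Poly_Mapping.lookup f m))"

text \<open>As usual, the zero polynomial is homogeneous of every degree.\<close>

definition homogeneous_of_degree :: "nat \<Rightarrow> 'a::zero pol \<Rightarrow> bool" where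
  "homogeneous_of_degree d f \<longleftrightarrow>
     (\<forall>m\<in>Poly_Mapping.keys f. (\<Sum>i\<in>UNIV. Poly_Mapping.lookup m i) = d)"

definition xw_symmetric :: "'a::comm_semiring_1 pol \<Rightarrow> bool" where
  "xw_symmetric f \<longleftrightarrow> subst_pol Const (\<lambda>i. Var (Transposition.transpose 1 4 i)) f = f"


subsection \<open>Subsets of projective space\<close>

text \<open>
  A point of the projective 3-space over the algebraic closure is given by its homogeneous
  coordinates, i.e. by a nonzero vector, and a set of points by the set of all homogeneous
  coordinate vectors of its members.  All sets below that arise from homogeneous polynomials are
  invariant under nonzero scalars, so inclusion, equality and nonemptiness agree with those of the
  corresponding sets of projective points.
\<close>

type_synonym 'a point = "'a alg_closure ^ 4"

definition eval_at :: "'a::field pol \<Rightarrow> 'a point \<Rightarrow> 'a alg_closure" where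
  "eval_at f P = subst_pol to_ac (\<lambda>i. P $ i) f"

definition surface :: "'a::field pol \<Rightarrow> 'a point set" where
  "surface f = {P. P \<noteq> 0 \<and> eval_at f P = 0}"

definition gradient :: "'a::field pol \<Rightarrow> 'a point \<Rightarrow> 'a alg_closure ^ 4" where
  "gradient f P = (\<chi> i. eval_at (partial_deriv i f) P)"

definition tangent_space :: "'a::field pol \<Rightarrow> 'a point \<Rightarrow> 'a point set" where
  "tangent_space f P =
     (if gradient f P \<noteq> 0 then {Q. Q \<noteq> 0 \<and> scalar_product (gradient f P) Q = 0}
      else {Q. Q \<noteq> 0})"


subsection \<open>The quadric and inversive curves\<close>

definition quadric_form :: "'a::field \<Rightarrow> 'a pol" where
  "quadric_form \<gamma> = Var 1 * Var 4 - Var 2 ^ 2 - Var 2 * Var 3 - Const \<gamma> * Var 3 ^ 2"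

definition quadric :: "'a::field \<Rightarrow> 'a point set" where
  "quadric \<gamma> = surface (quadric_form \<gamma>)"

definition inversive_curve :: "'a::field \<Rightarrow> 'a pol \<Rightarrow> 'a point set" where
  "inversive_curve \<gamma> f = surface f \<inter> quadric \<gamma>"

definition curve_tangent_space :: "'a::field \<Rightarrow> 'a pol \<Rightarrow> 'a point \<Rightarrow> 'a point set" where
  "curve_tangent_space \<gamma> f P = tangent_space f P \<inter> tangent_space (quadric_form \<gamma>) P"

definition plane_tangent_to_quadric :: "'a::field \<Rightarrow> 'a pol \<Rightarrow> bool" where
  "plane_tangent_to_quadric \<gamma> l \<longleftrightarrow>
     (\<exists>P\<in>quadric \<gamma>. surface l = tangent_space (quadric_form \<gamma>) P)"

text \<open>
  Tangent spaces are attached to the defining equations, so circles and hyperbolic lines are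
  represented by their linear forms.
\<close>

definition defines_circle :: "'a::field \<Rightarrow> 'a pol \<Rightarrow> bool" where
  "defines_circle \<gamma> l \<longleftrightarrow>
     l \<noteq> 0 \<and> homogeneous_of_degree 1 l \<and> \<not> plane_tangent_to_quadric \<gamma> l"

definition circle_tangent_to :: "'a::field \<Rightarrow> 'a pol \<Rightarrow> 'a pol \<Rightarrow> bool" where
  "circle_tangent_to \<gamma> l f \<longleftrightarrow>
     (\<exists>P \<in> inversive_curve \<gamma> l \<inter> inversive_curve \<gamma> f.
        curve_tangent_space \<gamma> l P \<subseteq> curve_tangent_space \<gamma> f P)"

definition circle_transverse_free :: "'a::field \<Rightarrow> 'a pol \<Rightarrow> bool" where
  "circle_transverse_free \<gamma> f \<longleftrightarrow> (\<forall>l. defines_circle \<gamma> l \<longrightarrow> circle_tangent_to \<gamma> l f)"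

definition base_circle :: "'a::field \<Rightarrow> 'a point set" where
  "base_circle \<gamma> = inversive_curve \<gamma> (Var 1 + Var 4)"

definition defines_hyperbolic_line :: "'a::field \<Rightarrow> 'a pol \<Rightarrow> bool" where
  "defines_hyperbolic_line \<gamma> l \<longleftrightarrow>
     defines_circle \<gamma> l \<and> xw_symmetric l \<and> inversive_curve \<gamma> l \<noteq> base_circle \<gamma>"

definition line_transverse_free :: "'a::field \<Rightarrow> 'a pol \<Rightarrow> bool" where
  "line_transverse_free \<gamma> f \<longleftrightarrow>
     (\<forall>l. defines_hyperbolic_line \<gamma> l \<longrightarrow> circle_tangent_to \<gamma> l f)"

end

theory Submission
  imports Defs
begin

text \<open>
  If \<open>f\<close> restricted to the quadric is singular at a rational point, then every circle through that
  point is tangent to the curve of \<open>f\<close>.  So it suffices to find a set \<open>H\<close> of rational points of the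
  quadric that meets every circle, and an \<open>f\<close> that is singular at all points of \<open>H\<close>.  The first
  moment method applied to the complement of \<open>H\<close> gives a small \<open>H\<close>, and since each point imposes
  three linear conditions, \<open>f\<close> exists as soon as \<open>3 |H|\<close> is less than the dimension \<open>(d + 1)\<^sup>2\<close> of
  the space of forms of degree \<open>d\<close> modulo the quadratic form; representatives modulo the quadratic
  form are the polynomials without monomials divisible by \<open>xw\<close>.  For hyperbolic lines, the points
  are the pairs of points exchanged by the symmetry, and it is enough that \<open>f\<close> is singular at one
  point of each pair.  The symmetric reduced forms have dimension \<open>(d + 1) (d + 2) / 2\<close>.
\<close>

subsection \<open>Blocking sets\<close>

text \<open>There are \<open>q^2 + 1\<close> rational points and at most \<open>q^3 + q\<close>
  circles, with \<open>q + 1\<close> points each, so \<open>m\<close> points containing no circle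
  exist once \<open>(q^3 + q) * (m choose (q+1)) < (q^2 + 1) choose (q + 1)\<close>. Since
  \<open>(q^2 + 1) * (q^2 choose q) = (q + 1) * ((q^2 + 1) choose (q + 1))\<close>, this says that
  \<open>m (m - 1) ... (m - q)\<close> is less than \<open>(q^2 choose q) * fact (q - 1)\<close>,
  the radicand of the bound; the degree then has to satisfy
  \<open>3 (q^2 + 1 - m) < (d + 1)^2\<close>. For hyperbolic lines there are
  \<open>n = q (q - 1) / 2\<close> points and at most \<open>q^2 - 1\<close> lines with
  \<open>q / 2\<close> points each, and the requirement is
  \<open>6 (n - m) < (d + 1) (d + 2)\<close>. As \<open>m\<close> is an integer and the root need
  not be one, rounding is the delicate point of both estimates. Three conditions per point suffice
  in every characteristic: by Euler's identity a zero \<open>p\<close> of \<open>f\<close> has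
  vanishing derivative in the direction \<open>p\<close>, which leaves the value and two tangential
  derivatives.\<close>

lemma card_supersets:
  assumes "finite S" "C \<subseteq> S" "card C \<le> m"
  shows "card {Y. C \<subseteq> Y \<and> Y \<subseteq> S \<and> card Y = m} = (card S - card C) choose (m - card C)"
proof -
  have finC: "finite C" using assms finite_subset by blast
  let ?A = "{Z. Z \<subseteq> S - C \<and> card Z = m - card C}"
  have "bij_betw (\<lambda>Z. Z \<union> C) ?A {Y. C \<subseteq> Y \<and> Y \<subseteq> S \<and> card Y = m}"
  proof (rule bij_betw_byWitness[where f' = "\<lambda>Y. Y - C"])
    show "(\<lambda>Z. Z \<union> C) ` ?A \<subseteq> {Y. C \<subseteq> Y \<and> Y \<subseteq> S \<and> card Y = m}"
    proof clarify
      fix Z assume Z: "Z \<subseteq> S - C" "card Z = m - card C"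
      have "card (Z \<union> C) = card Z + card C"
        using Z finC assms by (intro card_Un_disjoint) (auto intro: finite_subset)
      then show "C \<subseteq> Z \<union> C \<and> Z \<union> C \<subseteq> S \<and> card (Z \<union> C) = m"
        using Z assms by auto
    qed
    show "(\<lambda>Y. Y - C) ` {Y. C \<subseteq> Y \<and> Y \<subseteq> S \<and> card Y = m} \<subseteq> ?A"
      using finC by (auto simp: card_Diff_subset)
  qed auto
  then have "card {Y. C \<subseteq> Y \<and> Y \<subseteq> S \<and> card Y = m} = card ?A"
    by (simp add: bij_betw_same_card)
  also have "\<dots> = card (S - C) choose (m - card C)"
    using assms by (intro n_subsets) auto
  finally show ?thesis
    using assms finC by (simp add: card_Diff_subset)
qed

text \<open>First moment method: a uniformly random subset of size \<open>m\<close> contains fewer than one member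
  of \<open>F\<close> on average.\<close>

lemma exists_blocking_set:
  assumes S: "finite S" and F: "finite F" "\<And>C. C \<in> F \<Longrightarrow> C \<subseteq> S \<and> card C = k"
    and m: "m \<le> card S" and lt: "card F * (m choose k) < card S choose k"
  shows "\<exists>H\<subseteq>S. card H = card S - m \<and> (\<forall>C\<in>F. C \<inter> H \<noteq> {})"
proof -
  let ?N = "card S"
  define all where "all = {Y. Y \<subseteq> S \<and> card Y = m}"
  define sup where "sup C = {Y. C \<subseteq> Y \<and> Y \<subseteq> S \<and> card Y = m}" for C
  have card_all: "card all = ?N choose m"
    unfolding all_def using S by (rule n_subsets)
  have "\<exists>Y\<in>all. \<forall>C\<in>F. \<not> C \<subseteq> Y"
  proof (cases "k \<le> m")
    case True
    have cs: "card (sup C) = (?N - k) choose (m - k)" if "C \<in> F" for C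
      using card_supersets[OF S, of C m] F(2)[OF that] True unfolding sup_def by simp
    have "card (\<Union>C\<in>F. sup C) \<le> (\<Sum>C\<in>F. card (sup C))"
      using F(1) by (rule card_UN_le)
    also have "\<dots> = card F * ((?N - k) choose (m - k))"
      using cs by simp
    finally have le: "card (\<Union>C\<in>F. sup C) \<le> card F * ((?N - k) choose (m - k))" .
    \<comment> \<open>The factor \<open>m choose k\<close> makes \<open>choose_mult\<close>
      applicable, which counts pairs of a \<open>k\<close>-set inside an \<open>m\<close>-set in two
      ways.\<close>
    have "card F * ((?N - k) choose (m - k)) * (m choose k)
        < (?N choose k) * ((?N - k) choose (m - k))"
      using lt m True by (simp add: mult.commute mult.left_commute)
    also have "\<dots> = (?N choose m) * (m choose k)"
      using choose_mult[OF True m] by simp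
    finally have "card F * ((?N - k) choose (m - k)) < ?N choose m"
      by simp
    then have "card (\<Union>C\<in>F. sup C) < card all"
      using le card_all by linarith
    moreover have "(\<Union>C\<in>F. sup C) \<subseteq> all"
      unfolding sup_def all_def by auto
    ultimately have "(\<Union>C\<in>F. sup C) \<subset> all"
      by auto
    then obtain Y where "Y \<in> all" "Y \<notin> (\<Union>C\<in>F. sup C)"
      by blast
    then show ?thesis
      unfolding sup_def all_def by blast
  next
    case False
    have "card all > 0"
      using card_all m by simp
    then obtain Y where Y: "Y \<in> all"
      by (metis all_not_in_conv card.empty less_irrefl)
    have "\<not> C \<subseteq> Y" if "C \<in> F" for C
    proof
      assume "C \<subseteq> Y"
      moreover have "finite Y" using Y S finite_subset unfolding all_def by blast
      ultimately have "card C \<le> card Y" by (intro card_mono)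
      then show False using F(2)[OF that] Y False unfolding all_def by simp
    qed
    with Y show ?thesis by blast
  qed
  then obtain Y where Y: "Y \<subseteq> S" "card Y = m" "\<forall>C\<in>F. \<not> C \<subseteq> Y"
    unfolding all_def by blast
  have "card (S - Y) = ?N - m"
    using Y S by (simp add: card_Diff_subset finite_subset)
  moreover have "C \<inter> (S - Y) \<noteq> {}" if "C \<in> F" for C
    using Y(3) F(2)[OF that] that by blast
  ultimately show ?thesis
    by (intro exI[of _ "S - Y"]) auto
qed

text \<open>The first and third factors satisfy \<open>m (m - 2) \<le> (m - 1)^2\<close>, and every
  other factor is at most \<open>m - 1\<close>. Having \<open>m - 1\<close> instead of
  \<open>m\<close> in the base pays for rounding up to an integer.\<close>

lemma binomial_times_fact_le_power_pred:
  assumes "k \<ge> 3"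
  shows "(m choose k) * fact k \<le> (m - 1) ^ k"
proof (cases "m \<ge> 3")
  case True
  obtain n where n: "m = Suc (Suc (Suc n))"
    using True by (metis numeral_3_eq_3 Suc_le_D Suc_le_mono)
  obtain j where j: "k = Suc (Suc (Suc j))"
    using assms by (metis numeral_3_eq_3 Suc_le_D Suc_le_mono)
  have step: "(Suc a choose Suc b) * fact (Suc b) = Suc a * ((a choose b) * fact b)" for a b :: nat
  proof -
    have "(Suc a choose Suc b) * fact (Suc b) = (Suc b * (Suc a choose Suc b)) * fact b"
      by (simp add: algebra_simps)
    also have "Suc b * (Suc a choose Suc b) = Suc a * (a choose b)"
      by (rule Suc_times_binomial)
    finally show ?thesis by (simp only: mult.assoc)
  qed
  have "(m choose k) * fact k = (n+3) * ((n+2) * ((n+1) * ((n choose j) * fact j)))"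
    unfolding n j step by (simp add: numeral_3_eq_3)
  also have "\<dots> = ((n+3) * (n+1)) * ((n+2) * ((n choose j) * fact j))"
    by (simp only: mult.assoc mult.commute mult.left_commute)
  also have "\<dots> \<le> (n+2)^2 * ((n+2) * (n+2)^j)"
  proof (intro mult_mono)
    show "(n choose j) * fact j \<le> (n+2)^j"
      using binomial_fact_pow[of n j] power_mono[of n "n+2" j] by linarith
    show "(n+3)*(n+1) \<le> (n+2)^2"
      by (simp add: power2_eq_square algebra_simps)
  qed auto
  also have "\<dots> = (m - 1) ^ k"
    unfolding n j by (simp add: power2_eq_square algebra_simps)
  finally show ?thesis .
next
  case False
  then have "m < k" using assms by simp
  then show ?thesis by (simp add: binomial_eq_0)
qed

text \<open>Rounding \<open>r\<close> up is harmless: passing from \<open>m ^ (q + 1)\<close> to the falling factorial of \<open>m\<close>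
  gains more than it loses.\<close>

lemma circle_count_estimate:
  fixes q :: nat and r :: real
  assumes q: "q \<ge> 2"
    and r_def: "r = root (q + 1) (real ((q ^ 2) choose q) * fact (q - 1))"
  shows "\<exists>m. m \<le> q^2 + 1 \<and> r \<le> real m \<and> (q^3 + q) * (m choose (q+1)) < (q^2 + 1) choose (q + 1)"
proof (intro exI conjI)
  define A :: nat where "A = ((q ^ 2) choose q) * fact (q - 1)"
  have A: "A > 0"
    using q unfolding A_def by (simp add: power2_eq_square)
  have r_pow: "r ^ (q + 1) = real A"
    unfolding r_def A_def by (subst real_root_pow_pos2) auto
  have r_pos: "r > 0"
    using A unfolding r_def A_def by (simp add: zero_less_mult_iff)
  define m where "m = nat \<lceil>r\<rceil>"
  have m: "r \<le> real m" "real m < r + 1" "m \<ge> 1"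
    using r_pos unfolding m_def by linarith+
  show "r \<le> real m" by (rule m)
  \<comment> \<open>A crude bound suffices: it yields \<open>r \<le> q^2\<close>, so that the
    rounded-up \<open>m\<close> does not exceed the number \<open>q^2 + 1\<close> of points.\<close>
  have "A \<le> ((q ^ 2) choose q) * fact q"
    unfolding A_def by (intro mult_left_mono fact_mono) auto
  also have "\<dots> \<le> (q^2)^q"
    by (rule binomial_fact_pow)
  also have "\<dots> \<le> (q^2)^(q+1)"
    using q by (intro power_increasing) (auto simp: power2_eq_square)
  finally have "real A \<le> real ((q^2)^(q+1))"
    by (simp only: of_nat_le_iff)
  then have "r ^ (q+1) \<le> real (q^2) ^ (q+1)"
    unfolding r_pow by simp
  then have "r \<le> real (q^2)"
    by (rule power_le_imp_le_base[where n=q, unfolded Suc_eq_plus1]) simp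
  then show "m \<le> q^2 + 1"
    using m by linarith
  have "real ((m - 1)^(q+1)) < r^(q+1)"
    unfolding of_nat_power using m by (intro power_strict_mono) auto
  then have "(m-1)^(q+1) < A"
    unfolding r_pow by (simp only: of_nat_less_iff)
  then have "(m choose (q+1)) * fact (q+1) < A"
    using binomial_times_fact_le_power_pred[of "q+1" m] q by linarith
  moreover have "fact (q + 1) = (q+1) * q * (fact (q - 1) :: nat)"
    using q fact_reduce[of q, where ?'a=nat] by (simp add: algebra_simps)
  ultimately have "(m choose (q+1)) * ((q+1) * q * fact (q - 1)) < A"
    by (simp only:)
  then have "fact (q - 1) * ((q+1) * q * (m choose (q+1))) < fact (q-1) * (q^2 choose q)"
    unfolding A_def by (simp only: mult.assoc mult.commute mult.left_commute)
  then have "(q+1) * q * (m choose (q+1)) < q^2 choose q"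
    by simp
  then have "(q^2+1) * ((q+1) * q * (m choose (q+1))) < (q^2+1) * (q^2 choose q)"
    by (rule mult_strict_left_mono) simp
  also have "\<dots> = (q+1) * ((q^2+1) choose (q+1))"
    using Suc_times_binomial[of q "q^2"] by simp
  finally have "(q+1) * ((q^3 + q) * (m choose (q+1))) < (q+1) * ((q^2+1) choose (q+1))"
    by (simp add: algebra_simps power3_eq_cube power2_eq_square)
  then show "(q^3 + q) * (m choose (q+1)) < (q^2+1) choose (q+1)"
    by (simp only: mult_less_cancel1)
qed

text \<open>Here \<open>r\<close> is rounded down to some \<open>m < r\<close> with
  \<open>m \<ge> r - 1\<close>, so that the plain bound \<open>m ^ k\<close> for the falling
  factorial is enough. The loss is absorbed in the degree: as
  \<open>(d + 3)^2 - 1 = (d + 2) (d + 4)\<close>, it remains to see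
  \<open>(d + 2) (d + 4) + 24 \<le> 4 (d + 1) (d + 2)\<close>, which amounts to
  \<open>d (d + 2) \<ge> 8\<close>, that is \<open>d \<ge> 2\<close>.\<close>

lemma hyperbolic_line_count_estimate:
  fixes k d :: nat and r :: real
  defines "q \<equiv> 2 * k" and "n \<equiv> k * (2 * k - 1)"
  assumes k: "k \<ge> 1"
    and r_def: "r = root k (real (n choose k) * fact k / (real q ^ 2 - 1))"
    and d: "(real d + 3)^2 > 24 * (real n - r) + 1"
  shows "\<exists>m. m \<le> n \<and> (q^2 - 1) * (m choose k) < n choose k \<and> 6 * (n - m) < (d + 1) * (d + 2)"
proof (intro exI conjI)
  have q2: "real q ^ 2 - 1 \<ge> 3"
    using power_mono[of 2 "real q" 2] k unfolding q_def by simp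
  have nk: "n \<ge> k"
    using k unfolding n_def by simp
  have A: "real (n choose k) * fact k / (real q ^ 2 - 1) > 0"
    using nk q2 by simp
  have r_pow: "r ^ k = real (n choose k) * fact k / (real q ^ 2 - 1)"
    unfolding r_def using k A by (intro real_root_pow_pos2) auto
  have r_pos: "r > 0"
    unfolding r_def using A k by simp
  have le3: "3 * r ^ k \<le> real n ^ k"
  proof -
    have "3 * r^k \<le> (real q ^ 2 - 1) * r ^ k"
      using q2 r_pos by (intro mult_right_mono) auto
    also have "\<dots> = real ((n choose k) * fact k)"
      unfolding r_pow using q2 by simp
    also have "\<dots> \<le> real (n ^ k)"
      using binomial_fact_pow by (simp only: of_nat_le_iff)
    finally show ?thesis by simp
  qed
  have n_pos: "real n > 0" using nk k by simp
  \<comment> \<open>The value 5/8 satisfies \<open>24 * 5/8 + 1 = 4^2\<close>, which excludes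
    \<open>d \<le> 1\<close> below. Bernoulli's inequality with \<open>k \<le> n\<close> gives
    \<open>(n - 5/8)^k \<ge> 3/8 * n^k\<close>, and \<open>3 * 3/8 > 1\<close> then contradicts
    \<open>le3\<close>.\<close>
  have r_less: "r \<le> real n - 5/8"
  proof (rule ccontr)
    assume "\<not> ?thesis"
    then have gt: "real n - 5/8 < r" by simp
    define x where "x = - (5/8) / real n"
    have "real k * 1 \<le> real k * (2 * real k - 1)"
      using k by (intro mult_left_mono) auto
    then have nkr: "real k \<le> real n"
      using nk by simp
    have n1: "real n \<ge> 1" using nk k by linarith
    have "1 + real k * x \<le> (1 + x) ^ k"
      unfolding x_def using n1 by (intro Bernoulli_inequality) (auto simp: field_simps)
    moreover have "real k * x \<ge> - (5/8)"
      unfolding x_def using nkr n_pos by (simp add: field_simps)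
    ultimately have "3/8 \<le> (1 + x)^k" by linarith
    then have "3/8 * real n ^ k \<le> (1 + x)^k * real n ^ k"
      by (intro mult_right_mono) auto
    also have "\<dots> = (real n - 5/8) ^ k"
    proof -
      have "(1 + x) * real n = real n - 5/8"
        using n_pos by (simp add: x_def field_simps)
      then show ?thesis by (simp flip: power_mult_distrib)
    qed
    also have "\<dots> \<le> r ^ k"
      using gt n1 by (intro power_mono) auto
    finally have "3 * (3/8 * real n ^ k) \<le> real n ^ k" using le3 by linarith
    then show False using n_pos by (simp add: mult_le_0_iff)
  qed
  define m where "m = nat (\<lceil>r\<rceil> - 1)"
  have m: "real m < r" "r \<le> real m + 1"
    using r_pos unfolding m_def by linarith+
  show mn: "m \<le> n" using m r_less by linarith
  have "real m ^ k < r ^ k"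
    using m k by (intro power_strict_mono) auto
  moreover have "real ((m choose k) * fact k) \<le> real (m ^ k)"
    using binomial_fact_pow by (simp only: of_nat_le_iff)
  ultimately have "real (m choose k) * fact k < real (n choose k) * fact k / (real q ^ 2 - 1)"
    unfolding r_pow[symmetric] by simp
  then have "real (m choose k) * fact k * (real q ^ 2 - 1) < real (n choose k) * fact k"
    using q2 by (simp add: pos_less_divide_eq)
  then have "fact k * ((real q ^ 2 - 1) * real (m choose k)) < fact k * real (n choose k)"
    by (simp only: mult.assoc mult.commute mult.left_commute)
  then have "(real q ^ 2 - 1) * real (m choose k) < real (n choose k)"
    by (rule mult_left_less_imp_less) simp
  moreover have "real (q^2 - 1) = real q ^ 2 - 1"
    using k unfolding q_def by (simp add: of_nat_diff power2_eq_square)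
  ultimately have "real ((q^2 - 1) * (m choose k)) < real (n choose k)"
    by simp
  then show "(q^2 - 1) * (m choose k) < n choose k"
    by (simp only: of_nat_less_iff)
  have d2: "d \<ge> 2"
  proof (rule ccontr)
    assume "\<not> ?thesis"
    then have "(real d + 3)^2 \<le> 4^2"
      by (intro power_mono) auto
    then show False using d r_less by simp
  qed
  have "real d * (real d + 2) \<ge> 2 * (2 + 2)"
    using d2 by (intro mult_mono) auto
  then have "real (6 * (n - m)) < real ((d + 1) * (d + 2))"
    using d m mn by (simp add: of_nat_diff power2_eq_square algebra_simps)
  then show "6 * (n - m) < (d + 1) * (d + 2)"
    by (simp only: of_nat_less_iff)
qed

subsection \<open>Polynomials and the quadric\<close>

lemma subst_pol_superset:
  assumes "finite A" "Poly_Mapping.keys f \<subseteq> A" "h 0 = 0"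
  shows "subst_pol h v f =
    (\<Sum>m\<in>A. h (Poly_Mapping.lookup f m) * (\<Prod>i\<in>UNIV. v i ^ Poly_Mapping.lookup m i))"
  unfolding subst_pol_def using assms
  by (intro sum.mono_neutral_left) (auto simp: in_keys_iff)

lemma subst_pol_single:
  assumes "h 0 = 0"
  shows "subst_pol h v (Poly_Mapping.single m c) = h c * (\<Prod>i\<in>UNIV. v i ^ Poly_Mapping.lookup m i)"
  by (subst subst_pol_superset[of "{m}"]) (use assms in auto)

lemma subst_pol_diff:
  fixes h :: "'a::ab_group_add \<Rightarrow> 'b::comm_ring_1"
  assumes "\<And>x y. h (x - y) = h x - h y"
  shows "subst_pol h v (f - g) = subst_pol h v f - subst_pol h v g"
proof -
  have h0: "h 0 = 0" using assms[of 0 0] by simp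
  let ?A = "Poly_Mapping.keys f \<union> Poly_Mapping.keys g"
  have "Poly_Mapping.keys (f - g) \<subseteq> ?A"
    by (rule keys_diff)
  then show ?thesis
    using h0 by (simp add: subst_pol_superset[of ?A] lookup_minus assms left_diff_distrib
        sum_subtractf)
qed

lemma subst_pol_sum_single:
  fixes h :: "'a::ab_group_add \<Rightarrow> 'b::comm_ring_1"
  assumes "\<And>x y. h (x + y) = h x + h y" "finite A"
  shows "subst_pol h v (\<Sum>a\<in>A. Poly_Mapping.single (g a) (c a)) =
    (\<Sum>a\<in>A. h (c a) * (\<Prod>i\<in>UNIV. v i ^ Poly_Mapping.lookup (g a) i))"
proof -
  have h0: "h 0 = 0" using assms(1)[of 0 0] by simp
  have add: "subst_pol h v (f + f') = subst_pol h v f + subst_pol h v f'" for f f' :: "'a pol"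
  proof -
    let ?B = "Poly_Mapping.keys f \<union> Poly_Mapping.keys f'"
    have "Poly_Mapping.keys (f + f') \<subseteq> ?B"
      by (rule keys_add)
    then show ?thesis
      using h0 by (simp add: subst_pol_superset[of ?B] lookup_add assms distrib_right sum.distrib)
  qed
  have zero: "subst_pol h v 0 = 0" by (simp add: subst_pol_def)
  show ?thesis
    using assms(2) by (induction A) (auto simp: zero add subst_pol_single h0)
qed

lemma partial_deriv_superset:
  assumes "finite A" "Poly_Mapping.keys f \<subseteq> A"
  shows "partial_deriv i f =
    (\<Sum>m\<in>A. Poly_Mapping.single (m - Poly_Mapping.single i 1)
      (of_nat (Poly_Mapping.lookup m i) * Poly_Mapping.lookup f m))"
  unfolding partial_deriv_def using assms
  by (intro sum.mono_neutral_left) (auto simp: in_keys_iff)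

lemma partial_deriv_single:
  "partial_deriv i (Poly_Mapping.single m c) =
    Poly_Mapping.single (m - Poly_Mapping.single i 1) (of_nat (Poly_Mapping.lookup m i) * c)"
  by (subst partial_deriv_superset[of "{m}"]) auto

lemma partial_deriv_diff:
  fixes f g :: "'a::comm_ring_1 pol"
  shows "partial_deriv i (f - g) = partial_deriv i f - partial_deriv i g"
proof -
  let ?A = "Poly_Mapping.keys f \<union> Poly_Mapping.keys g"
  have "Poly_Mapping.keys (f - g) \<subseteq> ?A"
    by (rule keys_diff)
  then show ?thesis
    by (simp add: partial_deriv_superset[of ?A] lookup_minus right_diff_distrib single_diff
        sum_subtractf)
qed

text \<open>Stays over the base field, unlike \<open>gradient\<close>, so that singularity at a
  rational point becomes a system of linear conditions over the finite field.\<close>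

definition grad :: "'a::comm_ring_1 pol \<Rightarrow> 'a ^ 4 \<Rightarrow> 'a ^ 4" where
  "grad f p = (\<chi> i. subst_pol (\<lambda>c. c) (($) p) (partial_deriv i f))"

lemma grad_diff: "grad (f - g) p = grad f p - grad g p"
  by (simp add: grad_def vec_eq_iff partial_deriv_diff subst_pol_diff)

text \<open>Applied without dividing by \<open>d\<close>: at a zero \<open>p\<close> of
  \<open>f\<close> the gradient is orthogonal to \<open>p\<close>, whatever the
  characteristic.\<close>

lemma euler_identity:
  fixes f :: "'a::comm_ring_1 pol"
  assumes "homogeneous_of_degree d f"
  shows "scalar_product (grad f p) p = of_nat d * subst_pol (\<lambda>c. c) (($) p) f"
proof -
  let ?mon = "\<lambda>m. \<Prod>j\<in>UNIV. p $ j ^ Poly_Mapping.lookup m j"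
  \<comment> \<open>Subtraction of exponents is truncated, so lowering and then multiplying by
    \<open>p $ i\<close> fails to restore \<open>m\<close> when \<open>i\<close> does not occur in
    it; the factor \<open>of_nat 0\<close> covers that case.\<close>
  have mon: "of_nat (Poly_Mapping.lookup m i) * ?mon (m - Poly_Mapping.single i 1) * p $ i
      = of_nat (Poly_Mapping.lookup m i) * ?mon m" for m i
  proof (cases "Poly_Mapping.lookup m i = 0")
    case False
    have "?mon (m - Poly_Mapping.single i 1) * p $ i
        = (\<Prod>j\<in>UNIV. p $ j ^ Poly_Mapping.lookup (m - Poly_Mapping.single i 1) j *
            (if j = i then p $ i else 1))"
      by (simp add: prod.distrib prod.delta)
    also have "\<dots> = ?mon m"
    proof (intro prod.cong refl)
      fix j
      show "p $ j ^ Poly_Mapping.lookup (m - Poly_Mapping.single i 1) j *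
          (if j = i then p $ i else 1) = p $ j ^ Poly_Mapping.lookup m j"
        using False
        by (cases "Poly_Mapping.lookup m i") (auto simp: lookup_minus lookup_single)
    qed
    finally show ?thesis by (simp only: mult.assoc)
  qed simp
  have "scalar_product (grad f p) p =
    (\<Sum>i\<in>UNIV. \<Sum>m\<in>Poly_Mapping.keys f.
      Poly_Mapping.lookup f m * (of_nat (Poly_Mapping.lookup m i) * ?mon (m - Poly_Mapping.single i 1) * p $ i))"
    by (simp add: scalar_product_def grad_def partial_deriv_def subst_pol_sum_single
        sum_distrib_left sum_distrib_right mult_ac)
  also have "\<dots> = (\<Sum>m\<in>Poly_Mapping.keys f. \<Sum>i\<in>UNIV.
      Poly_Mapping.lookup f m * (of_nat (Poly_Mapping.lookup m i) * ?mon m))"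
    unfolding mon by (rule sum.swap)
  also have "\<dots> = (\<Sum>m\<in>Poly_Mapping.keys f.
      of_nat (\<Sum>i\<in>UNIV. Poly_Mapping.lookup m i) * (Poly_Mapping.lookup f m * ?mon m))"
    by (simp add: sum_distrib_left sum_distrib_right mult_ac)
  also have "\<dots> = of_nat d * subst_pol (\<lambda>c. c) (($) p) f"
    using assms by (simp add: homogeneous_of_degree_def subst_pol_def sum_distrib_left)
  finally show ?thesis .
qed

section \<open>Rational points, linear forms and the equation of the quadric\<close>

definition rational :: "'a::field ^ 4 \<Rightarrow> 'a point" where
  "rational p = (\<chi> i. to_ac (p $ i))"

lemma eval_at_rational: "eval_at f (rational p) = to_ac (subst_pol (\<lambda>c. c) (($) p) f)"
  by (simp add: eval_at_def subst_pol_def rational_def to_ac_sum to_ac_prod)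

lemma gradient_rational: "gradient f (rational p) = rational (grad f p)"
  by (simp add: gradient_def grad_def eval_at_rational[unfolded rational_def] rational_def)

lemma scalar_product_4:
  "scalar_product v w = v $ 1 * w $ 1 + v $ 2 * w $ 2 + v $ 3 * w $ 3 + v $ (4::4) * w $ 4"
  by (simp add: scalar_product_def sum_4)

definition coeff_vec :: "'a::zero pol \<Rightarrow> 'a ^ 4" where
  "coeff_vec l = (\<chi> i. Poly_Mapping.lookup l (Poly_Mapping.single i 1))"

lemma degree_one_exponent:
  fixes m :: "4 \<Rightarrow>\<^sub>0 nat"
  assumes "(\<Sum>i\<in>UNIV. Poly_Mapping.lookup m i) = 1"
  shows "\<exists>i. m = Poly_Mapping.single i 1"
proof -
  obtain i where i: "Poly_Mapping.lookup m i \<noteq> 0"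
    using assms by (metis sum.neutral zero_neq_one)
  have "Poly_Mapping.lookup m i + (\<Sum>j\<in>UNIV - {i}. Poly_Mapping.lookup m j) = 1"
    using assms by (simp add: sum.remove[of UNIV i])
  then have "Poly_Mapping.lookup m i = 1" "(\<Sum>j\<in>UNIV - {i}. Poly_Mapping.lookup m j) = 0"
    using i by linarith+
  then have "m = Poly_Mapping.single i 1"
    by (intro poly_mapping_eqI) (auto simp: lookup_single when_def sum_nonneg_eq_0_iff)
  then show ?thesis ..
qed

lemma linear_form_keys:
  fixes l :: "'a::zero pol"
  assumes "homogeneous_of_degree 1 l"
  shows "Poly_Mapping.keys l \<subseteq> range (\<lambda>i. Poly_Mapping.single i 1)"
  using assms degree_one_exponent unfolding homogeneous_of_degree_def by blast

lemma eval_at_linear_form: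
  assumes "homogeneous_of_degree 1 l"
  shows "eval_at l P = scalar_product (rational (coeff_vec l)) P"
proof -
  have inj: "inj (\<lambda>i::4. Poly_Mapping.single i (1::nat))"
    by (intro injI) (metis lookup_single_eq lookup_single_not_eq zero_neq_one)
  have mon: "(\<Prod>j\<in>UNIV. P $ j ^ Poly_Mapping.lookup (Poly_Mapping.single i (1::nat)) j) = P $ i"
    for i :: 4
  proof -
    have "(\<Prod>j\<in>UNIV. P $ j ^ Poly_Mapping.lookup (Poly_Mapping.single i (1::nat)) j)
        = (\<Prod>j\<in>UNIV. if j = i then P $ j else 1)"
      by (intro prod.cong) (auto simp: lookup_single)
    then show ?thesis by simp
  qed
  show ?thesis
    unfolding eval_at_def scalar_product_def
    by (subst subst_pol_superset[OF _ linear_form_keys[OF assms]])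
      (auto simp: sum.reindex[OF inj] mon rational_def coeff_vec_def simp del: One_nat_def)
qed

lemma coeff_vec_eq_0_iff:
  assumes "homogeneous_of_degree 1 l"
  shows "coeff_vec l = 0 \<longleftrightarrow> l = 0"
proof
  assume "coeff_vec l = 0"
  then have "Poly_Mapping.lookup l (Poly_Mapping.single i 1) = 0" for i
    by (simp add: coeff_vec_def vec_eq_iff)
  then have "m \<notin> Poly_Mapping.keys l" for m
    using linear_form_keys[OF assms] by (auto simp: in_keys_iff simp del: One_nat_def)
  then have "Poly_Mapping.keys l = {}" by blast
  then show "l = 0" by simp
qed (simp add: coeff_vec_def vec_eq_iff)

lemma quadric_form_single:
  "quadric_form \<gamma> =
     Poly_Mapping.single (Poly_Mapping.single 1 1 + Poly_Mapping.single 4 1) 1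
     - Poly_Mapping.single (Poly_Mapping.single 2 1 + Poly_Mapping.single 2 1) 1
     - Poly_Mapping.single (Poly_Mapping.single 2 1 + Poly_Mapping.single 3 1) 1
     - Poly_Mapping.single (Poly_Mapping.single 3 1 + Poly_Mapping.single 3 1) \<gamma>"
  by (simp add: quadric_form_def Var_def Const_def power2_eq_square mult_single)

lemma prod_4: "prod f (UNIV :: 4 set) = f 1 * f 2 * f 3 * f 4"
  unfolding UNIV_4 by (simp add: ac_simps)

lemma eval_at_quadric_form:
  "eval_at (quadric_form \<gamma>) P = P $ 1 * P $ 4 - P $ 2 ^ 2 - P $ 2 * P $ 3 - to_ac \<gamma> * P $ 3 ^ 2"
  by (simp add: eval_at_def quadric_form_single subst_pol_diff subst_pol_single prod_4
      lookup_add lookup_single power2_eq_square)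

lemma gradient_quadric_form:
  fixes P :: "'a::field point"
  shows "gradient (quadric_form \<gamma>) P $ 1 = P $ 4"
    "gradient (quadric_form \<gamma>) P $ 2 = - (2 * P $ 2 + P $ 3)"
    "gradient (quadric_form \<gamma>) P $ 3 = - (P $ 2 + 2 * to_ac \<gamma> * P $ 3)"
    "gradient (quadric_form \<gamma>) P $ 4 = P $ 1"
  by (simp_all add: gradient_def eval_at_def quadric_form_single subst_pol_diff subst_pol_single
      partial_deriv_diff partial_deriv_single prod_4 lookup_add lookup_minus lookup_single)

definition xw_reduced :: "'a::zero pol \<Rightarrow> bool" where
  "xw_reduced f \<longleftrightarrow> (\<forall>m\<in>Poly_Mapping.keys f. Poly_Mapping.lookup m 1 = 0 \<or> Poly_Mapping.lookup m 4 = 0)"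

lemma lookup_single_times:
  fixes g :: "'a::comm_ring_1 pol"
  shows "Poly_Mapping.lookup (Poly_Mapping.single k c * g) (k + m) = c * Poly_Mapping.lookup g m"
proof -
  have "Poly_Mapping.lookup (Poly_Mapping.single k c * g) (k + m)
      = (\<Sum>a. Poly_Mapping.lookup (Poly_Mapping.single k c) a *
          (\<Sum>b. Poly_Mapping.lookup g b when k + m = a + b))"
    by (rule lookup_mult)
  also have "\<dots> = (\<Sum>a. c * (\<Sum>b. Poly_Mapping.lookup g b when k + m = a + b) when k = a)"
    by (intro Sum_any.cong) (auto simp: lookup_single when_def)
  also have "\<dots> = c * Poly_Mapping.lookup g m"
    by simp
  finally show ?thesis .
qed

text \<open>The product of \<open>xw\<close> with the part of \<open>g\<close> of highest degree in \<open>x\<close> and \<open>w\<close> together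
  survives in \<open>quadric_form \<gamma> * g\<close>.\<close>

lemma quadric_form_not_dvd_reduced:
  fixes f :: "'a::field pol"
  assumes "xw_reduced f" "f \<noteq> 0"
  shows "\<not> quadric_form \<gamma> dvd f"
proof
  assume "quadric_form \<gamma> dvd f"
  then obtain g where f: "f = quadric_form \<gamma> * g" by (elim dvdE)
  define wt :: "(4 \<Rightarrow>\<^sub>0 nat) \<Rightarrow> nat"
    where "wt m = Poly_Mapping.lookup m 1 + Poly_Mapping.lookup m 4" for m
  have "g \<noteq> 0" using assms f by auto
  then have ne: "Poly_Mapping.keys g \<noteq> {}" by simp
  obtain m where m: "m \<in> Poly_Mapping.keys g" "\<And>n. n \<in> Poly_Mapping.keys g \<Longrightarrow> wt n \<le> wt m"
  proof -
    have fin: "finite (wt ` Poly_Mapping.keys g)" by simp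
    have "Max (wt ` Poly_Mapping.keys g) \<in> wt ` Poly_Mapping.keys g"
      using Max_in[OF fin] ne by blast
    then obtain m where "m \<in> Poly_Mapping.keys g" "wt m = Max (wt ` Poly_Mapping.keys g)"
      by (metis imageE)
    then show ?thesis using that fin by simp
  qed
  define m' where "m' = Poly_Mapping.single 1 1 + Poly_Mapping.single 4 1 + m"
  have wt_m': "wt m' = wt m + 2"
    by (simp add: m'_def wt_def lookup_add lookup_single)
  \<comment> \<open>The terms of the quadratic form other than \<open>xw\<close> have weight 0, and
    no exponent of \<open>g\<close> has weight above \<open>wt m\<close>, so these products never
    reach weight \<open>wt m + 2\<close>.\<close>
  have vanish: "Poly_Mapping.lookup (Poly_Mapping.single k c * g) m' = 0" if "wt k = 0" for k c
  proof (rule ccontr)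
    assume "Poly_Mapping.lookup (Poly_Mapping.single k c * g) m' \<noteq> 0"
    then have "m' \<in> Poly_Mapping.keys (Poly_Mapping.single k c * g)"
      by (simp add: in_keys_iff)
    then obtain n where "n \<in> Poly_Mapping.keys g" "m' = k + n"
      using keys_mult[of "Poly_Mapping.single k c" g] by (auto split: if_splits)
    then show False
      using m(2)[of n] wt_m' that by (simp add: wt_def lookup_add)
  qed
  \<comment> \<open>Multiplication by \<open>xw\<close> is injective on exponents, so other
    exponents of \<open>g\<close> with the same weight as \<open>m\<close> cannot cancel this
    coefficient.\<close>
  have "Poly_Mapping.lookup f m' = Poly_Mapping.lookup g m"
    unfolding f quadric_form_single left_diff_distrib lookup_minus
    by (subst (2 3 4) vanish)
      (simp_all add: wt_def lookup_add lookup_single m'_def lookup_single_times)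
  then have "m' \<in> Poly_Mapping.keys f"
    using m(1) by (simp add: in_keys_iff)
  then show False
    using assms(1) by (auto simp: xw_reduced_def m'_def lookup_add lookup_single)
qed

subsection \<open>Curves with prescribed singular points\<close>

definition vec4 :: "'b \<Rightarrow> 'b \<Rightarrow> 'b \<Rightarrow> 'b \<Rightarrow> 'b ^ 4" where
  "vec4 a b c d = (\<chi> i. if i = 1 then a else if i = 2 then b else if i = 3 then c else d)"

lemma vec4_nth [simp]:
  "vec4 a b c d $ 1 = a" "vec4 a b c d $ 2 = b" "vec4 a b c d $ 3 = c" "vec4 a b c d $ 4 = d"
  by (simp_all add: vec4_def)

text \<open>When \<open>t^2 + t + \<gamma>\<close> is irreducible with root \<open>t\<close>, this
  is the norm of \<open>y - z t\<close> from the quadratic extension, hence anisotropic.\<close>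

definition norm_form :: "'a::comm_ring_1 \<Rightarrow> 'a \<Rightarrow> 'a \<Rightarrow> 'a" where
  "norm_form \<gamma> y z = y ^ 2 + y * z + \<gamma> * z ^ 2"

text \<open>The rational points of the quadric: an affine plane and one point at infinity.\<close>

fun quadric_point :: "'a::comm_ring_1 \<Rightarrow> ('a \<times> 'a) option \<Rightarrow> 'a ^ 4" where
  "quadric_point \<gamma> None = vec4 1 0 0 0"
| "quadric_point \<gamma> (Some (y, z)) = vec4 (norm_form \<gamma> y z) y z 1"

text \<open>Together with \<open>quadric_point \<gamma> a\<close>, these two vectors span the tangent plane at that point.\<close>

fun tangent_vec1 :: "'a::comm_ring_1 \<Rightarrow> ('a \<times> 'a) option \<Rightarrow> 'a ^ 4" where
  "tangent_vec1 \<gamma> None = vec4 0 1 0 0"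
| "tangent_vec1 \<gamma> (Some (y, z)) = vec4 (2 * y + z) 1 0 0"

fun tangent_vec2 :: "'a::comm_ring_1 \<Rightarrow> ('a \<times> 'a) option \<Rightarrow> 'a ^ 4" where
  "tangent_vec2 \<gamma> None = vec4 0 0 1 0"
| "tangent_vec2 \<gamma> (Some (y, z)) = vec4 (y + 2 * \<gamma> * z) 0 1 0"

text \<open>The value and the first derivatives of \<open>f\<close> along the parametrisation of the
  quadric. It depends linearly on \<open>f\<close> and has three coordinates, the three conditions
  imposed at each point.\<close>

definition one_jet :: "'a::comm_ring_1 \<Rightarrow> 'a pol \<Rightarrow> ('a \<times> 'a) option \<Rightarrow> 'a \<times> 'a \<times> 'a" where
  "one_jet \<gamma> f a =
     (subst_pol (\<lambda>c. c) (($) (quadric_point \<gamma> a)) f,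
      scalar_product (grad f (quadric_point \<gamma> a)) (tangent_vec1 \<gamma> a),
      scalar_product (grad f (quadric_point \<gamma> a)) (tangent_vec2 \<gamma> a))"

lemma one_jet_diff: "one_jet \<gamma> (f - g) a = one_jet \<gamma> f a - one_jet \<gamma> g a"
  by (simp add: one_jet_def subst_pol_diff grad_diff scalar_product_4 algebra_simps)

lemma rational_nth [simp]: "rational p $ i = to_ac (p $ i)"
  by (simp add: rational_def)

lemma vec4_eq_iff:
  fixes v w :: "'b ^ 4"
  shows "v = w \<longleftrightarrow> v $ 1 = w $ 1 \<and> v $ 2 = w $ 2 \<and> v $ 3 = w $ 3 \<and> v $ 4 = w $ 4"
  by (simp add: vec_eq_iff forall_4)

lemma rational_quadric_point_in_quadric: "rational (quadric_point \<gamma> a) \<in> quadric \<gamma>"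
proof (cases a)
  case None
  then show ?thesis
    by (simp add: quadric_def surface_def eval_at_quadric_form vec4_eq_iff)
next
  case (Some b)
  then show ?thesis
    by (cases b) (simp add: quadric_def surface_def eval_at_quadric_form vec4_eq_iff norm_form_def
        algebra_simps)
qed

text \<open>The gradient of \<open>f\<close> is orthogonal to the point (by Euler) and to both
  tangent vectors (by the jet). These span the tangent plane also over the algebraic closure, where
  \<open>Q\<close> lives.\<close>

lemma one_jet_zero_tangent:
  fixes f :: "'a::field pol"
  assumes f: "homogeneous_of_degree d f" and jet: "one_jet \<gamma> f a = 0"
    and Q: "Q \<in> tangent_space (quadric_form \<gamma>) (rational (quadric_point \<gamma> a))"
  shows "Q \<in> tangent_space f (rational (quadric_point \<gamma> a))"
proof -
  define p where "p = quadric_point \<gamma> a"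
  define g where "g = grad f p"
  have "scalar_product g p = 0" "scalar_product g (tangent_vec1 \<gamma> a) = 0"
    "scalar_product g (tangent_vec2 \<gamma> a) = 0"
    using jet euler_identity[OF f, of p] by (simp_all add: one_jet_def g_def p_def zero_prod_def)
  then have sp: "scalar_product (rational g) (rational p) = 0"
    "scalar_product (rational g) (rational (tangent_vec1 \<gamma> a)) = 0"
    "scalar_product (rational g) (rational (tangent_vec2 \<gamma> a)) = 0"
    by (simp_all add: scalar_product_4 flip: to_ac_mult to_ac_add)
  have "gradient (quadric_form \<gamma>) (rational p) \<noteq> 0"
    unfolding p_def vec4_eq_iff gradient_quadric_form
    by (cases "(\<gamma>, a)" rule: quadric_point.cases) auto
  then have Q: "Q \<noteq> 0" "scalar_product (gradient (quadric_form \<gamma>) (rational p)) Q = 0"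
    using Q by (auto simp: tangent_space_def p_def)
  have "scalar_product (rational g) Q = 0"
  proof (cases a)
    case None
    then have "Q $ 4 = 0"
      using Q(2) by (simp add: p_def scalar_product_4 gradient_quadric_form)
    then show ?thesis
      using sp None by (simp add: p_def scalar_product_4)
  next
    case (Some b)
    obtain y z where b: "b = (y, z)" by (cases b)
    define y' z' \<gamma>' where "y' = to_ac y" and "z' = to_ac z" and "\<gamma>' = to_ac \<gamma>"
    have Q1: "Q $ 1 = (2 * y' + z') * Q $ 2 + (y' + 2 * \<gamma>' * z') * Q $ 3
        - (y' ^ 2 + y' * z' + \<gamma>' * z' ^ 2) * Q $ 4"
      using Q(2) Some b
      by (simp add: p_def scalar_product_4 gradient_quadric_form norm_form_def y'_def z'_def \<gamma>'_def
          algebra_simps)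
    \<comment> \<open>The coefficients are read off from the last three coordinates of
      \<open>Q\<close>; the first coordinate then agrees because of the tangent plane equation
      \<open>Q1\<close>.\<close>
    have "scalar_product (rational g) Q =
        Q $ 4 * scalar_product (rational g) (rational p)
        + (Q $ 2 - Q $ 4 * y') * scalar_product (rational g) (rational (tangent_vec1 \<gamma> a))
        + (Q $ 3 - Q $ 4 * z') * scalar_product (rational g) (rational (tangent_vec2 \<gamma> a))"
      using Some b
      by (simp add: p_def scalar_product_4 norm_form_def Q1 flip: y'_def z'_def \<gamma>'_def)
        (simp add: algebra_simps power2_eq_square)
    then show ?thesis using sp by simp
  qed
  then show ?thesis
    using Q(1) by (simp add: tangent_space_def gradient_rational g_def p_def)
qed

lemma circle_tangent_toI:
  fixes f l :: "'a::field pol"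
  assumes f: "homogeneous_of_degree d f" and jet: "one_jet \<gamma> f a = 0"
    and l: "homogeneous_of_degree 1 l" "scalar_product (coeff_vec l) (quadric_point \<gamma> a) = 0"
  shows "circle_tangent_to \<gamma> l f"
  unfolding circle_tangent_to_def
proof (intro bexI)
  let ?P = "rational (quadric_point \<gamma> a)"
  show "curve_tangent_space \<gamma> l ?P \<subseteq> curve_tangent_space \<gamma> f ?P"
    using one_jet_zero_tangent[OF f jet] by (auto simp: curve_tangent_space_def)
  have P: "?P \<in> quadric \<gamma>" by (rule rational_quadric_point_in_quadric)
  have "eval_at f ?P = 0"
    using jet by (simp add: eval_at_rational one_jet_def zero_prod_def)
  moreover have "eval_at l ?P = to_ac (scalar_product (coeff_vec l) (quadric_point \<gamma> a))"
    by (simp add: eval_at_linear_form[OF l(1)] scalar_product_4)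
  ultimately show "?P \<in> inversive_curve \<gamma> l \<inter> inversive_curve \<gamma> f"
    using P l(2) by (simp add: inversive_curve_def surface_def quadric_def)
qed

text \<open>Applied contrapositively: a form proportional to a gradient of the quadric defines no
  circle. The assumption \<open>nz\<close> rules out a vanishing gradient, where
  \<open>tangent_space\<close> would be the whole space.\<close>

lemma plane_tangent_to_quadricI:
  fixes l :: "'a::field pol"
  assumes l: "homogeneous_of_degree 1 l"
    and P: "P \<in> quadric \<gamma>" and c: "c \<noteq> 0"
    and eq: "\<And>i. to_ac (coeff_vec l $ i) = c * gradient (quadric_form \<gamma>) P $ i"
    and nz: "coeff_vec l \<noteq> 0"
  shows "plane_tangent_to_quadric \<gamma> l"
  unfolding plane_tangent_to_quadric_def
proof (intro bexI[OF _ P])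
  have "gradient (quadric_form \<gamma>) P \<noteq> 0"
  proof
    assume "gradient (quadric_form \<gamma>) P = 0"
    then have "to_ac (coeff_vec l $ i) = 0" for i using eq[of i] by simp
    then show False using nz by (simp add: vec_eq_iff)
  qed
  moreover have "eval_at l Q = c * scalar_product (gradient (quadric_form \<gamma>) P) Q" for Q
    by (simp add: eval_at_linear_form[OF l] scalar_product_4 eq algebra_simps)
  ultimately show "surface l = tangent_space (quadric_form \<gamma>) P"
    using c by (auto simp: surface_def tangent_space_def)
qed

section \<open>Reduced forms and the dimension count\<close>

definition reduced_exponents :: "nat \<Rightarrow> (4 \<Rightarrow>\<^sub>0 nat) set" where
  "reduced_exponents d = {m. (\<Sum>i\<in>UNIV. Poly_Mapping.lookup m i) = d \<and>
     (Poly_Mapping.lookup m 1 = 0 \<or> Poly_Mapping.lookup m 4 = 0)}"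

lemma finite_reduced_exponents: "finite (reduced_exponents d)"
proof (rule finite_imageD)
  have "Poly_Mapping.lookup m i \<le> d" if "m \<in> reduced_exponents d" for m i
  proof -
    have "Poly_Mapping.lookup m i \<le> (\<Sum>j\<in>UNIV. Poly_Mapping.lookup m j)"
      by (intro member_le_sum) simp_all
    then show ?thesis using that by (simp add: reduced_exponents_def)
  qed
  then have "Poly_Mapping.lookup ` reduced_exponents d \<subseteq> (\<Pi>\<^sub>E i\<in>UNIV. {..d})"
    by (simp add: image_subset_iff PiE_UNIV_domain Pi_def)
  then show "finite (Poly_Mapping.lookup ` reduced_exponents d)"
    by (rule finite_subset) (simp add: finite_PiE)
  show "inj_on Poly_Mapping.lookup (reduced_exponents d)"
    by (rule inj_onI) (simp only: poly_mapping_eq_iff)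
qed

text \<open>Coefficients are attached to labels \<open>\<rho> m\<close> rather than to monomials. An
  injective labelling leaves all coefficients free, while a labelling that identifies monomials
  forces equal coefficients; this treats general and symmetric forms at once.\<close>

definition reduced_pol :: "((4 \<Rightarrow>\<^sub>0 nat) \<Rightarrow> 'k) \<Rightarrow> nat \<Rightarrow> ('k \<Rightarrow> 'a) \<Rightarrow> 'a::zero pol" where
  "reduced_pol \<rho> d c = Abs_poly_mapping (\<lambda>m. if m \<in> reduced_exponents d then c (\<rho> m) else 0)"

lemma lookup_reduced_pol:
  "Poly_Mapping.lookup (reduced_pol \<rho> d c) m = (if m \<in> reduced_exponents d then c (\<rho> m) else 0)"
proof -
  have "finite {m. (if m \<in> reduced_exponents d then c (\<rho> m) else 0) \<noteq> 0}"
    by (rule finite_subset[OF _ finite_reduced_exponents[of d]]) auto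
  then show ?thesis by (simp add: reduced_pol_def)
qed

lemma keys_reduced_pol: "Poly_Mapping.keys (reduced_pol \<rho> d c) \<subseteq> reduced_exponents d"
  by (auto simp: in_keys_iff lookup_reduced_pol split: if_splits)

lemma homogeneous_reduced_pol: "homogeneous_of_degree d (reduced_pol \<rho> d c)"
  unfolding homogeneous_of_degree_def
  using keys_reduced_pol[of \<rho> d c] by (simp add: subset_iff reduced_exponents_def)

lemma xw_reduced_reduced_pol: "xw_reduced (reduced_pol \<rho> d c)"
  unfolding xw_reduced_def
  using keys_reduced_pol[of \<rho> d c] by (simp add: subset_iff reduced_exponents_def)

lemma card_gt_1: "CARD('a::{zero_neq_one,finite}) > 1"
proof -
  have "card {0, 1 :: 'a} \<le> CARD('a)" by (intro card_mono) auto
  then show ?thesis by simp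
qed

text \<open>Dimension count: singularity at a point costs three linear conditions.  Over a finite field
  the pigeonhole principle replaces linear algebra.\<close>

lemma exists_singular_reduced_pol:
  fixes \<gamma> :: "'a::{field,finite}"
  assumes H: "finite H" and K: "finite K" and card: "3 * card H < card K"
    and \<rho>: "K \<subseteq> \<rho> ` reduced_exponents d"
  shows "\<exists>c. reduced_pol \<rho> d c \<noteq> 0 \<and> (\<forall>a\<in>H. one_jet \<gamma> (reduced_pol \<rho> d c :: 'a pol) a = 0)"
proof -
  let ?jets = "\<lambda>c. \<lambda>a\<in>H. one_jet \<gamma> (reduced_pol \<rho> d c) a"
  let ?C = "\<Pi>\<^sub>E k\<in>K. (UNIV :: 'a set)"
  let ?J = "\<Pi>\<^sub>E a\<in>H. (UNIV :: ('a \<times> 'a \<times> 'a) set)"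
  have "card ?J = CARD('a) ^ (3 * card H)"
    using H by (simp add: card_PiE power_mult power3_eq_cube mult.assoc)
  also have "\<dots> < CARD('a) ^ card K"
    using card card_gt_1 by (intro power_strict_increasing)
  also have "\<dots> = card ?C"
    using K by (simp add: card_PiE)
  finally have "card ?J < card ?C" .
  moreover have "card (?jets ` ?C) \<le> card ?J"
    using H by (intro card_mono finite_PiE) auto
  ultimately have "\<not> inj_on ?jets ?C"
    by (intro pigeonhole) simp
  then obtain c c' where c: "c \<in> ?C" "c' \<in> ?C" "c \<noteq> c'" "?jets c = ?jets c'"
    by (auto simp: inj_on_def)
  have diff: "reduced_pol \<rho> d (\<lambda>k. c k - c' k) = reduced_pol \<rho> d c - reduced_pol \<rho> d c'"
    by (rule poly_mapping_eqI) (simp add: lookup_reduced_pol lookup_minus)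
  have "one_jet \<gamma> (reduced_pol \<rho> d (\<lambda>k. c k - c' k)) a = 0" if "a \<in> H" for a
    using fun_cong[OF c(4), of a] that by (simp add: diff one_jet_diff)
  moreover have "reduced_pol \<rho> d (\<lambda>k. c k - c' k) \<noteq> 0"
  proof -
    \<comment> \<open>Since \<open>\<rho>\<close> reaches every label in \<open>K\<close>, a
      difference at the label \<open>k\<close> is visible in an actual coefficient.\<close>
    obtain k where k: "k \<in> K" "c k \<noteq> c' k"
      using c(1-3) PiE_ext by metis
    then obtain m where "m \<in> reduced_exponents d" "\<rho> m = k"
      using \<rho> by blast
    then have "Poly_Mapping.lookup (reduced_pol \<rho> d (\<lambda>k. c k - c' k)) m \<noteq> 0"
      using k by (simp add: lookup_reduced_pol)
    then show ?thesis by auto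
  qed
  ultimately show ?thesis by blast
qed

definition exponent :: "nat \<Rightarrow> nat \<Rightarrow> nat \<Rightarrow> nat \<Rightarrow> 4 \<Rightarrow>\<^sub>0 nat" where
  "exponent i j k l = Poly_Mapping.single 1 i + Poly_Mapping.single 2 j
     + Poly_Mapping.single 3 k + Poly_Mapping.single 4 l"

lemma lookup_exponent [simp]:
  "Poly_Mapping.lookup (exponent i j k l) 1 = i" "Poly_Mapping.lookup (exponent i j k l) 2 = j"
  "Poly_Mapping.lookup (exponent i j k l) 3 = k" "Poly_Mapping.lookup (exponent i j k l) 4 = l"
  by (simp_all add: exponent_def lookup_add lookup_single)

text \<open>The bidegree \<open>(d, d)\<close> forms on the quadric: the exponents of \<open>y\<close> and \<open>z\<close> determine a reduced
  monomial of degree \<open>d\<close> up to exchanging \<open>x\<close> and \<open>w\<close>, and reflecting those with \<open>w\<close> at the centre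
  of the square fills up the square \<open>{..d} \<times> {..d}\<close>.\<close>

definition square_index :: "nat \<Rightarrow> (4 \<Rightarrow>\<^sub>0 nat) \<Rightarrow> nat \<times> nat" where
  "square_index d m = (if Poly_Mapping.lookup m 4 = 0
    then (Poly_Mapping.lookup m 2, Poly_Mapping.lookup m 3)
    else (d - Poly_Mapping.lookup m 2, d - Poly_Mapping.lookup m 3))"

lemma square_index_surj: "{..d} \<times> {..d} \<subseteq> square_index d ` reduced_exponents d"
proof
  fix p assume "p \<in> {..d} \<times> {..d}"
  then obtain j k where p: "p = (j, k)" and jk: "j \<le> d" "k \<le> d" by auto
  have "(j, k) \<in> square_index d ` reduced_exponents d"
  proof (cases "j + k \<le> d")
    case True
    then show ?thesis
      by (intro image_eqI[of _ _ "exponent (d - j - k) j k 0"])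
        (auto simp: square_index_def reduced_exponents_def sum_4)
  next
    case False
    \<comment> \<open>The exponent \<open>j + k - d\<close> of \<open>w\<close> is positive here, so
      \<open>square_index\<close> takes its reflecting branch and undoes \<open>d - j\<close> and
      \<open>d - k\<close>.\<close>
    then show ?thesis using jk
      by (intro image_eqI[of _ _ "exponent 0 (d - j) (d - k) (j + k - d)"])
        (auto simp: square_index_def reduced_exponents_def sum_4)
  qed
  then show "p \<in> square_index d ` reduced_exponents d" by (simp only: p)
qed

text \<open>This labelling forgets the exponents of \<open>x\<close> and \<open>w\<close>, so mirror
  monomials share one coefficient and the resulting forms are symmetric.\<close>

lemma triangle_index_surj:
  "(SIGMA j:{..d}. {..d - j}) \<subseteq>
    (\<lambda>m. (Poly_Mapping.lookup m 2, Poly_Mapping.lookup m (3::4))) ` reduced_exponents d"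
proof clarify
  fix j k assume jk: "j \<le> d" "k \<le> d - j"
  then show "(j, k) \<in> (\<lambda>m. (Poly_Mapping.lookup m 2, Poly_Mapping.lookup m (3::4))) ` reduced_exponents d"
    by (intro image_eqI[of _ _ "exponent (d - j - k) j k 0"])
      (auto simp: reduced_exponents_def sum_4)
qed

lemma card_triangle: "2 * card (SIGMA j:{..d}. {..d - j}) = (d + 1) * (d + 2)"
proof -
  have "card (SIGMA j:{..d}. {..d - j}) = (\<Sum>j\<le>d. Suc (d - j))"
    by (simp add: card_SigmaI)
  also have "\<dots> = (\<Sum>j\<le>d. Suc j)"
    by (rule sum.nat_diff_reindex[of Suc "Suc d", unfolded lessThan_Suc_atMost, simplified])
  also have "2 * \<dots> = (d + 1) * (d + 2)"
    by (induction d) auto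
  finally show ?thesis .
qed

section \<open>The exchange of x and w on exponents and coefficients\<close>

abbreviation swap_xw :: "(4 \<Rightarrow>\<^sub>0 nat) \<Rightarrow> 4 \<Rightarrow>\<^sub>0 nat" where
  "swap_xw \<equiv> Poly_Mapping.map_key (Transposition.transpose 1 4)"

lemma lookup_swap_xw:
  "Poly_Mapping.lookup (swap_xw m) i = Poly_Mapping.lookup m (Transposition.transpose 1 4 i)"
  by (simp add: map_key.rep_eq)

lemma swap_xw_swap_xw [simp]: "swap_xw (swap_xw m) = m"
  by (intro poly_mapping_eqI) (simp add: lookup_swap_xw)

lemma prod_single:
  "finite A \<Longrightarrow> (\<Prod>i\<in>A. Poly_Mapping.single (g i) (1::'a::comm_semiring_1)) = Poly_Mapping.single (\<Sum>i\<in>A. g i) 1"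
  by (induction A rule: finite_induct) (auto simp: mult_single)

lemma Var_power: "Var i ^ n = Poly_Mapping.single (Poly_Mapping.single i n) (1::'a::comm_semiring_1)"
  by (induction n) (auto simp: Var_def mult_single simp flip: single_add)

text \<open>The substitution permutes monomials by an involution, so the new coefficient at
  \<open>m\<close> is the old one at \<open>swap_xw m\<close>.\<close>

lemma xw_symmetric_iff:
  fixes f :: "'a::comm_semiring_1 pol"
  shows "xw_symmetric f \<longleftrightarrow> (\<forall>m. Poly_Mapping.lookup f (swap_xw m) = Poly_Mapping.lookup f m)"
proof -
  let ?\<tau> = "Transposition.transpose 1 (4::4)"
  have mon: "(\<Prod>i\<in>UNIV. Var (?\<tau> i) ^ Poly_Mapping.lookup m i) = Poly_Mapping.single (swap_xw m) (1::'a)"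
    for m
  proof -
    have "(\<Sum>i\<in>UNIV. Poly_Mapping.single (?\<tau> i) (Poly_Mapping.lookup m i)) = swap_xw m"
    proof (rule poly_mapping_eqI)
      fix i :: 4
      show "Poly_Mapping.lookup (\<Sum>i\<in>UNIV. Poly_Mapping.single (?\<tau> i) (Poly_Mapping.lookup m i)) i
          = Poly_Mapping.lookup (swap_xw m) i"
        using exhaust_4[of i]
        by (auto simp: sum_4 lookup_add lookup_single lookup_swap_xw Transposition.transpose_def)
    qed
    then show ?thesis by (simp add: Var_power prod_single)
  qed
  have swap_eq: "swap_xw n = m \<longleftrightarrow> n = swap_xw m" for m n :: "4 \<Rightarrow>\<^sub>0 nat"
    by (metis swap_xw_swap_xw)
  have "subst_pol Const (\<lambda>i. Var (?\<tau> i)) f =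
    (\<Sum>m\<in>Poly_Mapping.keys f. Poly_Mapping.single (swap_xw m) (Poly_Mapping.lookup f m))"
    by (simp add: subst_pol_def mon Const_def mult_single)
  then have "Poly_Mapping.lookup (subst_pol Const (\<lambda>i. Var (?\<tau> i)) f) m
      = (\<Sum>n\<in>Poly_Mapping.keys f. if n = swap_xw m then Poly_Mapping.lookup f n else 0)" for m
    by (simp add: lookup_sum lookup_single when_def swap_eq)
  then have "Poly_Mapping.lookup (subst_pol Const (\<lambda>i. Var (?\<tau> i)) f) m
      = Poly_Mapping.lookup f (swap_xw m)" for m
    by (simp add: in_keys_iff when_def)
  then show ?thesis
    by (simp add: xw_symmetric_def poly_mapping_eq_iff fun_eq_iff)
qed

lemma xw_symmetric_coeff_vec:
  assumes "xw_symmetric l"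
  shows "coeff_vec l $ 1 = coeff_vec l $ 4"
proof -
  have "swap_xw (Poly_Mapping.single 1 1) = Poly_Mapping.single 4 1"
    by (intro poly_mapping_eqI) (auto simp: lookup_swap_xw lookup_single when_def Transposition.transpose_def)
  then show ?thesis
    using assms unfolding xw_symmetric_iff coeff_vec_def by (metis vec_lambda_beta)
qed

lemma xw_symmetric_reduced_pol:
  "xw_symmetric (reduced_pol (\<lambda>m. (Poly_Mapping.lookup m 2, Poly_Mapping.lookup m 3)) d c)"
proof -
  have "swap_xw m \<in> reduced_exponents d \<longleftrightarrow> m \<in> reduced_exponents d" for m
    by (auto simp: reduced_exponents_def sum_4 lookup_swap_xw Transposition.transpose_def)
  then show ?thesis
    by (simp add: xw_symmetric_iff lookup_reduced_pol lookup_swap_xw Transposition.transpose_def)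
qed

subsection \<open>Circles\<close>

locale elliptic_quadric =
  fixes \<gamma> :: "'a::{field,finite}"
  assumes no_root: "t ^ 2 + t + \<gamma> \<noteq> 0"
begin

abbreviation N :: "'a \<Rightarrow> 'a \<Rightarrow> 'a" where "N \<equiv> norm_form \<gamma>"

lemma norm_form_eq_0_iff: "N y z = 0 \<longleftrightarrow> y = 0 \<and> z = 0"
proof
  assume N: "N y z = 0"
  have "z = 0"
  proof (rule ccontr)
    assume z: "z \<noteq> 0"
    have "(y / z) ^ 2 + y / z + \<gamma> = N y z / z ^ 2"
      using z by (simp add: norm_form_def field_simps power2_eq_square)
    then show False using N no_root[of "y / z"] by simp
  qed
  then show "y = 0 \<and> z = 0" using N by (simp add: norm_form_def)
qed (simp add: norm_form_def)

text \<open>If \<open>4 * \<gamma> = 1\<close>, then \<open>- 2 * \<gamma>\<close> would be a root.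
  This is the determinant of the linear system for the centre of a circle.\<close>

lemma discriminant_nonzero: "1 - 4 * \<gamma> \<noteq> 0"
proof
  assume "1 - 4 * \<gamma> = 0"
  then have "\<gamma> * (1 - 4 * \<gamma>) = 0" by simp
  then have "(- 2 * \<gamma>) ^ 2 + (- 2 * \<gamma>) + \<gamma> = 0"
    by (simp add: algebra_simps power2_eq_square)
  then show False using no_root by blast
qed

lemma norm_form_add_scaled:
  "N (y + s * u) (z + s * v) =
    N y z + s * ((2 * y + z) * u + (y + 2 * \<gamma> * z) * v) + s ^ 2 * N u v"
  by (simp add: norm_form_def algebra_simps power2_eq_square)

text \<open>One representative for each point of the projective line.\<close>

definition directions :: "('a \<times> 'a) set" where
  "directions = insert (0, 1) (range (\<lambda>c. (1, c)))"

lemma card_directions: "card directions = CARD('a) + 1"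
proof -
  have "card (range (\<lambda>c::'a. (1::'a, c))) = CARD('a)"
    by (intro card_image injI) simp
  moreover have "(0, 1) \<notin> range (\<lambda>c::'a. (1::'a, c))"
    by auto
  ultimately show ?thesis unfolding directions_def by simp
qed

lemma directions_nonzero: "(b, c) \<in> directions \<Longrightarrow> b \<noteq> 0 \<or> c \<noteq> 0"
  by (auto simp: directions_def)

lemma normalise_direction:
  assumes "b \<noteq> 0 \<or> c \<noteq> 0"
  shows "\<exists>r b' c'. r \<noteq> 0 \<and> (b', c') \<in> directions \<and> b = r * b' \<and> c = r * c'"
proof (cases "b = 0")
  case True
  then show ?thesis
    using assms by (intro exI[of _ c] exI[of _ 0] exI[of _ 1]) (simp add: directions_def)
next
  case False
  then show ?thesis
    by (intro exI[of _ b] exI[of _ 1] exI[of _ "c / b"]) (simp add: directions_def)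
qed

definition norm_fibre :: "'a \<Rightarrow> ('a \<times> 'a) set" where
  "norm_fibre k = {(y, z). N y z = k}"

text \<open>Each line through a point of the conic \<open>norm_fibre k\<close> meets it in at most one further point,
  and the tangent line meets it in none.\<close>

lemma card_norm_fibre_le: "card (norm_fibre k) \<le> CARD('a) + 1"
proof (cases "norm_fibre k = {}")
  case False
  then obtain y z where p: "N y z = k" by (auto simp: norm_fibre_def)
  define B where "B u v = (2 * y + z) * u + (y + 2 * \<gamma> * z) * v" for u v
  \<comment> \<open>\<open>B\<close> is the polar form of \<open>N\<close> at the base point
    \<open>(y, z)\<close>, and \<open>g\<close> sends a direction to the second intersection of its
    line with the conic.\<close>
  define g where "g = (\<lambda>(u, v). (y + - B u v / N u v * u, z + - B u v / N u v * v))"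
  have line: "s = - B u v / N u v" if "N (y + s * u) (z + s * v) = k" "s \<noteq> 0" "(u, v) \<in> directions" for s u v
  proof -
    have "s * (B u v + s * N u v) = 0"
      using that(1) p norm_form_add_scaled[of y s u z v] by (simp add: B_def algebra_simps power2_eq_square)
    then have "s * N u v = - B u v"
      using that(2) by (simp add: add_eq_0_iff2)
    moreover have "N u v \<noteq> 0"
      using directions_nonzero[OF that(3)] norm_form_eq_0_iff by blast
    ultimately show ?thesis by (simp add: field_simps)
  qed
  have "norm_fibre k \<subseteq> g ` directions"
  proof
    fix p' assume "p' \<in> norm_fibre k"
    then obtain y' z' where p': "p' = (y', z')" "N y' z' = k"
      by (auto simp: norm_fibre_def)
    show "p' \<in> g ` directions"
    proof (cases "y' = y \<and> z' = z")
      case True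
      \<comment> \<open>The base point is the image of the tangent direction, so it costs nothing
        beyond the \<open>q + 1\<close> directions.\<close>
      have "\<exists>u v. (u, v) \<in> directions \<and> B u v = 0"
      proof (cases "B 0 1 = 0")
        case True
        then show ?thesis unfolding directions_def by blast
      next
        case False
        then have "B 1 (- (2 * y + z) / (y + 2 * \<gamma> * z)) = 0"
          by (simp add: B_def)
        then show ?thesis unfolding directions_def by blast
      qed
      then obtain u v where "(u, v) \<in> directions" "B u v = 0" by blast
      then show ?thesis
        using True p' by (intro image_eqI[of _ _ "(u, v)"]) (simp_all add: g_def)
    next
      case False
      then have "y' - y \<noteq> 0 \<or> z' - z \<noteq> 0" by simp
      then obtain s u v where s: "s \<noteq> 0" "(u, v) \<in> directions" "y' - y = s * u" "z' - z = s * v"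
        using normalise_direction by metis
      then have eq: "y' = y + s * u" "z' = z + s * v"
        by (simp_all add: algebra_simps)
      have "s = - B u v / N u v"
        using line[of s u v] p' eq s by simp
      then show ?thesis
        using s p' eq by (intro image_eqI[of _ _ "(u, v)"]) (simp_all add: g_def)
    qed
  qed
  then have "card (norm_fibre k) \<le> card (g ` directions)"
    by (intro card_mono) auto
  also have "\<dots> \<le> card directions"
    by (intro card_image_le) auto
  finally show ?thesis by (simp add: card_directions)
qed simp

text \<open>The fibres partition the plane, the zero fibre is one point, and
  \<open>q^2 = 1 + (q - 1) (q + 1)\<close>. Hence the upper bound must be attained at each of the
  \<open>q - 1\<close> nonzero values.\<close>

lemma card_norm_fibre:
  assumes "k \<noteq> 0"
  shows "card (norm_fibre k) = CARD('a) + 1"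
proof (rule ccontr)
  let ?q = "CARD('a)"
  assume ne: "card (norm_fibre k) \<noteq> ?q + 1"
  have f0: "norm_fibre 0 = {(0, 0)}"
    by (auto simp: norm_fibre_def norm_form_eq_0_iff)
  have fib: "norm_fibre j = {p \<in> UNIV. case_prod N p = j}" for j
    by (auto simp: norm_fibre_def)
  have "?q * ?q = (\<Sum>p\<in>(UNIV :: ('a \<times> 'a) set). 1)"
    by simp
  also have "\<dots> = (\<Sum>j\<in>UNIV. \<Sum>p\<in>{p \<in> UNIV. case_prod N p = j}. 1)"
    by (rule sum.group[symmetric]) auto
  also have "\<dots> = (\<Sum>j\<in>UNIV. card (norm_fibre j))"
    by (simp add: fib)
  also have "\<dots> = 1 + (\<Sum>j\<in>UNIV - {0}. card (norm_fibre j))"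
    by (subst sum.remove[of UNIV 0]) (auto simp: f0)
  also have "\<dots> < 1 + (\<Sum>j\<in>UNIV - {0 :: 'a}. ?q + 1)"
  proof -
    have "(\<Sum>j\<in>UNIV - {0}. card (norm_fibre j)) < (\<Sum>j\<in>UNIV - {0 :: 'a}. ?q + 1)"
      using assms ne card_norm_fibre_le by (intro sum_strict_mono_ex1) (auto simp: le_less)
    then show ?thesis by simp
  qed
  also have "\<dots> = 1 + (?q - 1) * (?q + 1)"
    by (simp add: card_Diff_subset)
  also have "\<dots> = ?q * ?q"
    using card_gt_1[where 'a = 'a] by (cases ?q) auto
  finally show False by simp
qed

section \<open>Plane sections of the quadric in affine coordinates\<close>

definition affine_line :: "'a \<Rightarrow> 'a \<Rightarrow> 'a \<Rightarrow> ('a \<times> 'a) set" where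
  "affine_line b c e = {(y, z). b * y + c * z + e = 0}"

lemma card_affine_line:
  assumes "(b, c) \<in> directions"
  shows "card (affine_line b c e) = CARD('a)"
proof (cases "b = 0")
  case True
  then have "affine_line b c e = (\<lambda>y. (y, - e)) ` UNIV"
    using assms by (auto simp: affine_line_def directions_def add_eq_0_iff2)
  moreover have "inj (\<lambda>y::'a. (y, - e))" by (auto intro: injI)
  ultimately show ?thesis by (simp add: card_image)
next
  case False
  then have "affine_line b c e = (\<lambda>z. (- (c * z + e), z)) ` UNIV"
    using assms by (auto simp: affine_line_def directions_def add_eq_0_iff2 add.assoc)
  moreover have "inj (\<lambda>z. (- (c * z + e), z))" by (auto intro: injI)
  ultimately show ?thesis by (simp add: card_image)
qed

definition affine_circle :: "'a \<Rightarrow> 'a \<Rightarrow> 'a \<Rightarrow> ('a \<times> 'a) set" where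
  "affine_circle y0 z0 k = {(y, z). N (y - y0) (z - z0) = k}"

lemma card_affine_circle:
  assumes "k \<noteq> 0"
  shows "card (affine_circle y0 z0 k) = CARD('a) + 1"
proof -
  have "bij_betw (\<lambda>(y, z). (y + y0, z + z0)) (norm_fibre k) (affine_circle y0 z0 k)"
    by (rule bij_betw_byWitness[where f' = "\<lambda>(y, z). (y - y0, z - z0)"])
      (auto simp: norm_fibre_def affine_circle_def)
  then have "card (norm_fibre k) = card (affine_circle y0 z0 k)"
    by (rule bij_betw_same_card)
  then show ?thesis using card_norm_fibre[OF assms] by simp
qed

text \<open>Projection from the point \<open>None\<close>: circles through it become affine lines,
  the others translates of norm fibres. The numbers \<open>(q + 1) q\<close> and
  \<open>q^2 (q - 1)\<close> of parameters add up to \<open>q^3 + q\<close>.\<close>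

definition circles :: "('a \<times> 'a) option set set" where
  "circles =
     (\<lambda>((b, c), e). insert None (Some ` affine_line b c e)) ` (directions \<times> UNIV) \<union>
     (\<lambda>(y0, z0, k). Some ` affine_circle y0 z0 k) ` (UNIV \<times> UNIV \<times> (UNIV - {0}))"

lemma card_circles: "card circles \<le> CARD('a) ^ 3 + CARD('a)"
proof -
  let ?q = "CARD('a)"
  have "card circles \<le> card (directions \<times> (UNIV :: 'a set))
      + card ((UNIV :: 'a set) \<times> (UNIV :: 'a set) \<times> (UNIV - {0 :: 'a}))"
    unfolding circles_def
    by (intro order_trans[OF card_Un_le] add_mono card_image_le) auto
  also have "\<dots> = (?q + 1) * ?q + ?q * (?q * (?q - 1))"
    by (simp add: card_cartesian_product card_directions card_Diff_subset)
  also have "\<dots> = ?q ^ 3 + ?q"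
    using card_gt_1[where 'a = 'a] by (cases ?q) (auto simp: power3_eq_cube algebra_simps)
  finally show ?thesis .
qed

lemma card_circle:
  assumes "C \<in> circles"
  shows "card C = CARD('a) + 1"
proof -
  consider (line) x where "x \<in> directions \<times> UNIV"
      "C = (\<lambda>((b, c), e). insert None (Some ` affine_line b c e)) x"
    | (conic) x where "x \<in> UNIV \<times> UNIV \<times> (UNIV - {0})"
      "C = (\<lambda>(y0, z0, k). Some ` affine_circle y0 z0 k) x"
    using assms unfolding circles_def by (elim UnE imageE)
  then show ?thesis
  proof cases
    case line
    then obtain b c e where bc: "(b, c) \<in> directions" and C: "C = insert None (Some ` affine_line b c e)"
      by auto
    have "card (Some ` affine_line b c e) = CARD('a)"
      using card_affine_line[OF bc] by (simp add: card_image)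
    then show ?thesis
      unfolding C by (subst card_insert_disjoint) auto
  next
    case conic
    then obtain y0 z0 k where "k \<noteq> 0" "C = Some ` affine_circle y0 z0 k"
      by auto
    then show ?thesis using card_affine_circle[of k y0 z0] by (simp add: card_image)
  qed
qed

text \<open>The coefficient \<open>a\<close> of \<open>x\<close> vanishes exactly when the plane
  passes through \<open>None\<close>, and then the section is a line. Otherwise completing the
  square gives centre and radius; the degenerate cases are tangent planes.\<close>

lemma circle_points:
  assumes "defines_circle \<gamma> l"
  shows "\<exists>C\<in>circles. \<forall>p\<in>C. scalar_product (coeff_vec l) (quadric_point \<gamma> p) = 0"
proof -
  have l: "homogeneous_of_degree 1 l" and nt: "\<not> plane_tangent_to_quadric \<gamma> l" and "l \<noteq> 0"
    using assms by (auto simp: defines_circle_def)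
  then have nz: "coeff_vec l \<noteq> 0"
    using coeff_vec_eq_0_iff by blast
  define a b c e where "a = coeff_vec l $ 1" and "b = coeff_vec l $ 2" and "c = coeff_vec l $ 3"
    and "e = coeff_vec l $ 4"
  note co = a_def[symmetric] b_def[symmetric] c_def[symmetric] e_def[symmetric]
  have not_tangent: False
    if "r \<noteq> 0" and "\<forall>i. to_ac (coeff_vec l $ i)
      = to_ac r * gradient (quadric_form \<gamma>) (rational (quadric_point \<gamma> p)) $ i" for r p
    using plane_tangent_to_quadricI[OF l rational_quadric_point_in_quadric, of "to_ac r" \<gamma> p] that nz nt
    by simp
  show ?thesis
  proof (cases "a = 0")
    case True
    have "b \<noteq> 0 \<or> c \<noteq> 0"
    proof (rule ccontr)
      assume bc: "\<not> (b \<noteq> 0 \<or> c \<noteq> 0)"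
      have "e \<noteq> 0"
        using nz bc True by (auto simp: vec4_eq_iff co)
      moreover have "\<forall>i. to_ac (coeff_vec l $ i)
          = to_ac e * gradient (quadric_form \<gamma>) (rational (quadric_point \<gamma> None)) $ i"
        using bc True by (simp add: forall_4 gradient_quadric_form co)
      ultimately show False by (rule not_tangent)
    qed
    then obtain r b' c' where r: "r \<noteq> 0" "(b', c') \<in> directions" "b = r * b'" "c = r * c'"
      using normalise_direction by blast
    have "insert None (Some ` affine_line b' c' (e / r)) \<in> circles"
      unfolding circles_def using r(2)
      by (intro UnI1 image_eqI[of _ _ "((b', c'), e / r)"]) auto
    moreover have "scalar_product (coeff_vec l) (quadric_point \<gamma> (Some (y, z))) = 0"
      if "(y, z) \<in> affine_line b' c' (e / r)" for y z
    proof -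
      have "b * y + c * z + e = r * (b' * y + c' * z + e / r)"
        using r by (simp add: algebra_simps)
      also have "\<dots> = 0"
        using that by (simp add: affine_line_def)
      finally show ?thesis using True by (simp add: scalar_product_4 co)
    qed
    moreover have "scalar_product (coeff_vec l) (quadric_point \<gamma> None) = 0"
      using True by (simp add: scalar_product_4 co)
    ultimately show ?thesis by (intro bexI) auto
  next
    case False
    \<comment> \<open>The centre solves \<open>b = - a * (2 * y0 + z0)\<close> and
      \<open>c = - a * (y0 + 2 * \<gamma> * z0)\<close>. Eliminating \<open>y0\<close> through
      \<open>2 * c - b\<close> avoids dividing by 2.\<close>
    define z0 where "z0 = (2 * c - b) / (a * (1 - 4 * \<gamma>))"
    define y0 where "y0 = - c / a - 2 * \<gamma> * z0"
    define k where "k = N y0 z0 - e / a"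
    have c_eq: "c = - a * (y0 + 2 * \<gamma> * z0)"
      using False by (simp add: y0_def algebra_simps)
    have "(1 - 4 * \<gamma>) * (a * z0) = 2 * c - b"
      using False discriminant_nonzero by (simp add: z0_def)
    then have "b + a * z0 = - (a * (2 * y0))"
      unfolding c_eq by (simp add: algebra_simps)
    then have "b = - (a * (2 * y0)) - a * z0"
      by (metis add_diff_cancel_right')
    also have "\<dots> = - a * (2 * y0 + z0)"
      by (simp add: algebra_simps)
    finally have b_eq: "b = - a * (2 * y0 + z0)" .
    have e_eq: "e = a * (N y0 z0 - k)"
      using False by (simp add: k_def)
    show ?thesis
    proof (cases "k = 0")
      case True
      have "\<forall>i. to_ac (coeff_vec l $ i)
          = to_ac a * gradient (quadric_form \<gamma>) (rational (quadric_point \<gamma> (Some (y0, z0)))) $ i"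
        using True by (simp add: forall_4 gradient_quadric_form co b_eq c_eq e_eq algebra_simps)
      then show ?thesis using not_tangent False by blast
    next
      case k: False
      have "Some ` affine_circle y0 z0 k \<in> circles"
        unfolding circles_def using k by blast
      moreover have "scalar_product (coeff_vec l) (quadric_point \<gamma> (Some (y, z))) = 0"
        if "(y, z) \<in> affine_circle y0 z0 k" for y z
      proof -
        have "scalar_product (coeff_vec l) (quadric_point \<gamma> (Some (y, z)))
            = a * N y z + b * y + c * z + e"
          by (simp add: scalar_product_4 co)
        also have "\<dots> = a * (N (y - y0) (z - z0) - k)"
          unfolding b_eq c_eq e_eq by (simp add: norm_form_def algebra_simps power2_eq_square)
        also have "\<dots> = 0"
          using that by (simp add: affine_circle_def)
        finally show ?thesis .
      qed
      ultimately show ?thesis by (intro bexI) auto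
    qed
  qed
qed

end

lemma no_root_of_irreducible:
  fixes \<gamma> :: "'a::field"
  assumes "Factorial_Ring.irreducible [:\<gamma>, 1, 1:]"
  shows "t ^ 2 + t + \<gamma> \<noteq> 0"
proof
  assume "t ^ 2 + t + \<gamma> = 0"
  then have "poly [:\<gamma>, 1, 1:] t = 0"
    by (simp add: algebra_simps power2_eq_square)
  then obtain g where g: "[:\<gamma>, 1, 1:] = [:-t, 1:] * g"
    by (metis poly_eq_0_iff_dvd dvdE)
  have "g \<noteq> 0" using g by auto
  then have "Polynomial.degree [:\<gamma>, 1, 1:] = 1 + Polynomial.degree g"
    unfolding g by (subst degree_mult_eq) auto
  then have "Polynomial.degree g = 1" by simp
  then have "\<not> g dvd 1" "\<not> [:-t, 1:] dvd 1"
    using \<open>g \<noteq> 0\<close> is_unit_iff_degree[of g] is_unit_iff_degree[of "[:-t, 1:]"] by auto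
  then show False
    using Factorial_Ring.irreducibleD[OF assms g] by blast
qed

text \<open>Valid for either sign of \<open>x\<close> and \<open>c\<close>, because
  \<open>c^2 \<le> x\<close> would imply \<open>c \<le> sqrt x\<close>.\<close>

lemma less_power2_if_sqrt_less: "sqrt x < c \<Longrightarrow> x < c ^ 2"
  using real_le_rsqrt[of c x] by linarith

theorem circle_transverse_free_exists:
  fixes \<gamma> :: "'a::{field,finite}" and q d :: nat
  assumes q: "q = CARD('a)"
    and \<gamma>: "Factorial_Ring.irreducible [:\<gamma>, 1, 1:]"
    and d: "real d > -1 + sqrt (3 * (real q ^ 2 + 1
                     - root (q + 1) (real ((q ^ 2) choose q) * fact (q - 1))))"
  shows "\<exists>f :: 'a pol. homogeneous_of_degree d f \<and> \<not> quadric_form \<gamma> dvd f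
              \<and> circle_transverse_free \<gamma> f"
proof -
  interpret elliptic_quadric \<gamma>
    using no_root_of_irreducible[OF \<gamma>] by unfold_locales
  define r where "r = root (q + 1) (real ((q ^ 2) choose q) * fact (q - 1))"
  have "q \<ge> 2" using card_gt_1[where 'a = 'a] q by simp
  then obtain m where m: "m \<le> q^2 + 1" "r \<le> real m"
    "(q^3 + q) * (m choose (q+1)) < (q^2 + 1) choose (q + 1)"
    using circle_count_estimate r_def by blast
  have pts: "card (UNIV :: ('a \<times> 'a) option set) = q^2 + 1"
    by (simp add: q card_UNIV_option power2_eq_square)
  have "card circles * (m choose (q+1)) \<le> (q^3 + q) * (m choose (q+1))"
    using card_circles by (intro mult_right_mono) (auto simp: q)
  then have "card circles * (m choose (q+1)) < card (UNIV :: ('a \<times> 'a) option set) choose (q+1)"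
    unfolding pts using m(3) by (rule le_less_trans)
  then obtain H :: "('a \<times> 'a) option set" where H: "card H = q^2 + 1 - m" "\<And>C. C \<in> circles \<Longrightarrow> C \<inter> H \<noteq> {}"
    using exists_blocking_set[of UNIV circles "q+1" m] m(1) card_circle q pts by auto
  have "3 * (real q ^ 2 + 1 - r) < (real d + 1) ^ 2"
    using d by (intro less_power2_if_sqrt_less) (simp add: r_def)
  then have "3 * (real q ^ 2 + 1 - real m) < (real d + 1) ^ 2"
    using m(2) by simp
  then have "real (3 * card H) < real ((d + 1) * (d + 1))"
    unfolding H(1) using m(1) by (simp add: of_nat_diff power2_eq_square algebra_simps)
  then have "3 * card H < (d + 1) * (d + 1)"
    by (simp only: of_nat_less_iff)
  then have "3 * card H < card ({..d} \<times> {..d})"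
    by simp
  then obtain c where c: "reduced_pol (square_index d) d c \<noteq> (0 :: 'a pol)"
    "\<And>a. a \<in> H \<Longrightarrow> one_jet \<gamma> (reduced_pol (square_index d) d c :: 'a pol) a = 0"
    using exists_singular_reduced_pol[OF _ _ _ square_index_surj] by (metis finite finite_SigmaI finite_atMost)
  have "circle_tangent_to \<gamma> l (reduced_pol (square_index d) d c)" if l: "defines_circle \<gamma> l" for l
  proof -
    obtain C where "C \<in> circles" "\<forall>p\<in>C. scalar_product (coeff_vec l) (quadric_point \<gamma> p) = 0"
      using circle_points[OF l] by blast
    then obtain p where "p \<in> H" "scalar_product (coeff_vec l) (quadric_point \<gamma> p) = 0"
      using H(2) by blast
    then show ?thesis
      using l by (intro circle_tangent_toI[OF homogeneous_reduced_pol c(2)]) (auto simp: defines_circle_def)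
  qed
  then show ?thesis
    using c(1) quadric_form_not_dvd_reduced[OF xw_reduced_reduced_pol] homogeneous_reduced_pol
    unfolding circle_transverse_free_def by blast
qed

subsection \<open>Hyperbolic lines\<close>

locale elliptic_quadric_char_2 = elliptic_quadric \<gamma> for \<gamma> :: "'a::finite_field" +
  assumes even_card: "even CARD('a)"
begin

section \<open>Arithmetic in characteristic 2\<close>

lemma two_eq_0: "(2 :: 'a) = 0"
proof -
  have "(- 1 :: 'a) ^ CARD('a) = - 1"
    by (rule finite_field_power_card_eq_same)
  then have "(1 :: 'a) = - 1" using even_card by simp
  then show ?thesis by (metis one_add_one add.right_inverse)
qed

lemma add_self [simp]: "x + x = (0 :: 'a)"
  using two_eq_0 by (metis mult_2 mult_zero_left)

lemma neg_eq: "- x = (x :: 'a)"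
  by (simp add: minus_unique)

lemma add_eq_0: "x + y = 0 \<longleftrightarrow> x = (y :: 'a)"
  by (metis add_self add_eq_0_iff neg_eq)

lemma exists_sqrt: "\<exists>s. s ^ 2 = (x :: 'a)"
proof
  show "(x ^ (CARD('a) div 2)) ^ 2 = x"
    using even_card finite_field_power_card_eq_same[of x] by (simp flip: power_mult)
qed

lemma power2_add: "(x + y) ^ 2 = x ^ 2 + (y :: 'a) ^ 2"
  by (simp add: power2_sum two_eq_0)

lemma power2_inj: "x ^ 2 = y ^ 2 \<longleftrightarrow> x = (y :: 'a)"
  by (metis add_eq_0 power2_add zero_eq_power2)

text \<open>The image of an additive map with kernel \<open>{0, 1}\<close>, hence a subgroup of
  index 2. It decides solvability: \<open>x (x + 1) = v\<close> has a solution exactly when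
  \<open>v\<close> lies in it.\<close>

definition artin_schreier :: "'a set" where
  "artin_schreier = range (\<lambda>t. t ^ 2 + t)"

lemma artin_schreier_add:
  assumes "v \<in> artin_schreier"
  shows "u + v \<in> artin_schreier \<longleftrightarrow> u \<in> artin_schreier"
proof -
  have add: "u + v \<in> artin_schreier" if uv: "u \<in> artin_schreier" "v \<in> artin_schreier" for u v
  proof -
    obtain s t where "u = s ^ 2 + s" "v = t ^ 2 + t"
      using uv by (auto simp: artin_schreier_def)
    then have "u + v = (s + t) ^ 2 + (s + t)"
      by (simp add: power2_add algebra_simps)
    then show ?thesis by (auto simp: artin_schreier_def)
  qed
  show ?thesis
    using add[OF _ assms, of u] add[OF _ assms, of "u + v"] by (auto simp: add.assoc)
qed

lemma card_artin_schreier: "2 * card artin_schreier = CARD('a)"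
proof -
  have fibre: "card {t. t ^ 2 + t = v} = 2" if v: "v \<in> artin_schreier" for v
  proof -
    obtain s where s: "v = s ^ 2 + s" using v by (auto simp: artin_schreier_def)
    have "t ^ 2 + t = v \<longleftrightarrow> t = s \<or> t = s + 1" for t
    proof -
      have "t ^ 2 + t = v \<longleftrightarrow> (t ^ 2 + t) + (s ^ 2 + s) = 0"
        by (simp only: s add_eq_0)
      also have "\<dots> \<longleftrightarrow> (t + s) ^ 2 + (t + s) = 0"
        by (simp only: power2_add add_ac)
      also have "\<dots> \<longleftrightarrow> (t + s) * (t + (s + 1)) = 0"
        by (simp add: power2_eq_square algebra_simps)
      finally show ?thesis by (simp add: add_eq_0)
    qed
    then have "{t. t ^ 2 + t = v} = {s, s + 1}" by auto
    then show ?thesis by simp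
  qed
  have "CARD('a) = (\<Sum>t\<in>(UNIV :: 'a set). 1)" by simp
  also have "\<dots> = (\<Sum>v\<in>artin_schreier. \<Sum>t\<in>{t \<in> UNIV. t ^ 2 + t = v}. 1)"
    by (rule sum.group[symmetric]) (auto simp: artin_schreier_def)
  also have "\<dots> = 2 * card artin_schreier"
    by (simp add: fibre)
  finally show ?thesis by simp
qed

text \<open>A pair \<open>(y, z)\<close> stands for the two points \<open>(x, y, z, x + 1)\<close> of the quadric, which the
  symmetry exchanging \<open>x\<close> and \<open>w\<close> permutes.\<close>

definition hyperbolic_points :: "('a \<times> 'a) set" where
  "hyperbolic_points = {(y, z). N y z \<in> artin_schreier}"

text \<open>Where \<open>x + w = 1\<close>, the symmetric form \<open>a (x + w) + b y + c z\<close>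
  becomes \<open>b y + c z + a\<close>.\<close>

definition hyperbolic_line :: "'a \<Rightarrow> 'a \<Rightarrow> 'a \<Rightarrow> ('a \<times> 'a) set" where
  "hyperbolic_line b c a = hyperbolic_points \<inter> affine_line b c a"

text \<open>In characteristic 2 the line has direction vector \<open>(c, b)\<close>, as
  \<open>b c + c b = 0\<close>.\<close>

lemma affine_line_param:
  assumes "(b, c) \<in> directions"
  shows "\<exists>y0 z0. b * y0 + c * z0 = a
    \<and> bij_betw (\<lambda>t. (y0 + t * c, z0 + t * b)) UNIV (affine_line b c a)"
proof (cases "b = 0")
  case True
  then have bc: "b = 0" "c = 1" using assms by (auto simp: directions_def)
  have "bij_betw (\<lambda>t. (0 + t * c, a + t * b)) UNIV (affine_line b c a)"
    by (rule bij_betw_byWitness[where f' = fst]) (auto simp: affine_line_def bc add_eq_0)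
  then show ?thesis
    using bc by (intro exI[of _ 0] exI[of _ a]) simp
next
  case False
  then have b: "b = 1" using assms by (auto simp: directions_def)
  have "affine_line b c a = {(y, z). y = c * z + a}"
    by (simp add: affine_line_def b add.assoc add_eq_0)
  then have "bij_betw (\<lambda>t. (a + t * c, 0 + t * b)) UNIV (affine_line b c a)"
    by (intro bij_betw_byWitness[where f' = snd]) (auto simp: b add.commute mult.commute)
  then show ?thesis
    using b by (intro exI[of _ a] exI[of _ 0]) simp
qed

text \<open>Along a line, \<open>N\<close> is a quadratic polynomial in the parameter \<open>t\<close> with leading term
  \<open>(s t)\<^sup>2\<close>, which may be replaced by \<open>s t\<close> modulo \<open>artin_schreier\<close>.\<close>

lemma hyperbolic_line_param:
  assumes dir: "(b, c) \<in> directions" and s: "s ^ 2 = N c b"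
  shows "\<exists>y0 z0. b * y0 + c * z0 = a
    \<and> bij_betw (\<lambda>t. (y0 + t * c, z0 + t * b)) {t. N y0 z0 + t * (a + s) \<in> artin_schreier}
        (hyperbolic_line b c a)"
proof -
  obtain y0 z0 where p: "b * y0 + c * z0 = a"
    and bij: "bij_betw (\<lambda>t. (y0 + t * c, z0 + t * b)) UNIV (affine_line b c a)"
    using affine_line_param[OF dir] by blast
  have "N (y0 + t * c) (z0 + t * b) \<in> artin_schreier
      \<longleftrightarrow> N y0 z0 + t * (a + s) \<in> artin_schreier" for t
  proof -
    have "(s * t) ^ 2 + s * t \<in> artin_schreier" by (auto simp: artin_schreier_def)
    moreover have "N (y0 + t * c) (z0 + t * b) = N y0 z0 + t * (a + s) + ((s * t) ^ 2 + s * t)"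
    proof -
      \<comment> \<open>With \<open>2 = 0\<close> the polar term is \<open>z0 * c + y0 * b\<close>,
        which equals \<open>a\<close>.\<close>
      have "N (y0 + t * c) (z0 + t * b) = N y0 z0 + t * a + t ^ 2 * s ^ 2"
        unfolding norm_form_add_scaled s p[symmetric] by (simp add: two_eq_0 mult.commute add.commute)
      also have "\<dots> = N y0 z0 + t * a + (s * t) ^ 2 + (s * t + s * t)"
        by (simp add: power_mult_distrib mult.commute)
      also have "\<dots> = N y0 z0 + t * (a + s) + ((s * t) ^ 2 + s * t)"
        by (simp only: distrib_left mult.commute add_ac)
      finally show ?thesis .
    qed
    ultimately show ?thesis by (simp only: artin_schreier_add)
  qed
  then have "{t. N y0 z0 + t * (a + s) \<in> artin_schreier}
      = (\<lambda>t. (y0 + t * c, z0 + t * b)) -` hyperbolic_points"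
    by (auto simp: hyperbolic_points_def)
  then have "bij_betw (\<lambda>t. (y0 + t * c, z0 + t * b)) {t. N y0 z0 + t * (a + s) \<in> artin_schreier}
      (hyperbolic_line b c a)"
    using bij inj_on_subset[OF _ subset_UNIV]
    by (auto simp: bij_betw_def hyperbolic_line_def image_vimage_eq)
  then show ?thesis using p by blast
qed

text \<open>Since \<open>a \<noteq> s\<close>, the parameter enters through an affine bijection of
  the field, so the condition selects as many parameters as \<open>artin_schreier\<close> has
  elements, namely half of them.\<close>

lemma card_hyperbolic_line:
  assumes dir: "(b, c) \<in> directions" and a: "a ^ 2 \<noteq> N c b"
  shows "2 * card (hyperbolic_line b c a) = CARD('a)"
proof -
  obtain s where s: "s ^ 2 = N c b" using exists_sqrt by blast
  then have as: "a + s \<noteq> 0" using a by (auto simp: add_eq_0)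
  obtain y0 z0 where "bij_betw (\<lambda>t. (y0 + t * c, z0 + t * b))
      {t. N y0 z0 + t * (a + s) \<in> artin_schreier} (hyperbolic_line b c a)"
    using hyperbolic_line_param[OF dir s] by blast
  then have "card (hyperbolic_line b c a) = card {t. N y0 z0 + t * (a + s) \<in> artin_schreier}"
    by (simp add: bij_betw_same_card)
  also have "\<dots> = card artin_schreier"
  proof (rule bij_betw_same_card)
    show "bij_betw (\<lambda>t. N y0 z0 + t * (a + s)) {t. N y0 z0 + t * (a + s) \<in> artin_schreier} artin_schreier"
      by (rule bij_betw_byWitness[where f' = "\<lambda>v. (v - N y0 z0) / (a + s)"]) (use as in auto)
  qed
  finally show ?thesis using card_artin_schreier by simp
qed

text \<open>The plane is sliced by fixing \<open>y\<close>. The slice with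
  \<open>y^2 = \<gamma>\<close> is empty, because \<open>N\<close> is there congruent to
  \<open>\<gamma>\<close> modulo \<open>artin_schreier\<close> and \<open>\<gamma>\<close> lies
  outside it; each of the other \<open>q - 1\<close> slices has \<open>q / 2\<close> points.\<close>

lemma card_hyperbolic_points: "2 * card hyperbolic_points = CARD('a) * (CARD('a) - 1)"
proof -
  obtain s where s: "s ^ 2 = N 0 1" using exists_sqrt by blast
  have dir: "(1, 0) \<in> directions" by (auto simp: directions_def)
  have empty: "hyperbolic_line 1 0 s = {}"
  proof -
    obtain y0 z0 where p: "1 * y0 + 0 * z0 = s" and bij: "bij_betw (\<lambda>t. (y0 + t * 0, z0 + t * 1))
        {t. N y0 z0 + t * (s + s) \<in> artin_schreier} (hyperbolic_line 1 0 s)"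
      using hyperbolic_line_param[OF dir s] by blast
    have "N y0 z0 = \<gamma> + ((s * z0) ^ 2 + s * z0)"
    proof -
      have "s ^ 2 = \<gamma>" using s by (simp add: norm_form_def)
      then show ?thesis using p by (simp add: norm_form_def power_mult_distrib add_ac)
    qed
    moreover have "(s * z0) ^ 2 + s * z0 \<in> artin_schreier" by (auto simp: artin_schreier_def)
    moreover have "\<gamma> \<notin> artin_schreier"
      using no_root by (auto simp: artin_schreier_def add_eq_0)
    ultimately have "N y0 z0 \<notin> artin_schreier" by (simp only: artin_schreier_add not_False_eq_True)
    then show ?thesis using bij by (simp add: bij_betw_def)
  qed
  have other: "2 * card (hyperbolic_line 1 0 a) = CARD('a)" if "a \<noteq> s" for a
    using card_hyperbolic_line[OF dir] that s power2_inj by metis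
  have line: "{p \<in> hyperbolic_points. fst p = a} = hyperbolic_line 1 0 a" for a
    by (auto simp: hyperbolic_line_def affine_line_def add_eq_0)
  have "card hyperbolic_points = (\<Sum>p\<in>hyperbolic_points. 1)" by simp
  also have "\<dots> = (\<Sum>a\<in>UNIV. \<Sum>p\<in>{p \<in> hyperbolic_points. fst p = a}. 1)"
    by (rule sum.group[symmetric]) auto
  also have "\<dots> = (\<Sum>a\<in>UNIV. card (hyperbolic_line 1 0 a))"
    by (simp add: line)
  also have "\<dots> = (\<Sum>a\<in>UNIV - {s}. card (hyperbolic_line 1 0 a))"
    by (subst sum.remove[of UNIV s]) (auto simp: empty)
  finally have "2 * card hyperbolic_points = (\<Sum>a\<in>UNIV - {s}. 2 * card (hyperbolic_line 1 0 a))"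
    by (simp add: sum_distrib_left)
  also have "\<dots> = (\<Sum>a\<in>UNIV - {s}. CARD('a))"
    by (intro sum.cong) (auto simp: other)
  also have "\<dots> = CARD('a) * (CARD('a) - 1)"
    by (simp add: card_Diff_subset mult.commute)
  finally show ?thesis .
qed

text \<open>The excluded offset is the one for which the plane is tangent to the quadric. Squaring
  is bijective, so each of the \<open>q + 1\<close> directions keeps \<open>q - 1\<close>
  offsets.\<close>

definition hyperbolic_lines :: "('a \<times> 'a) set set" where
  "hyperbolic_lines =
     (\<lambda>((b, c), a). hyperbolic_line b c a) ` (SIGMA (b, c):directions. {a. a ^ 2 \<noteq> N c b})"

lemma card_hyperbolic_lines: "card hyperbolic_lines \<le> CARD('a) ^ 2 - 1"
proof -
  have "card {a. a ^ 2 \<noteq> D} \<le> CARD('a) - 1" for D :: 'a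
  proof -
    obtain s where "s ^ 2 = D" using exists_sqrt by blast
    then have "{a. a ^ 2 \<noteq> D} \<subseteq> UNIV - {s}" by auto
    then have "card {a. a ^ 2 \<noteq> D} \<le> card (UNIV - {s})" by (intro card_mono) auto
    then show ?thesis by (simp add: card_Diff_subset)
  qed
  then have "(\<Sum>(b, c)\<in>directions. card {a. a ^ 2 \<noteq> N c b}) \<le> (\<Sum>p\<in>directions. CARD('a) - 1)"
    by (intro sum_mono) (simp add: split_def)
  moreover have "card (SIGMA (b, c):directions. {a. a ^ 2 \<noteq> N c b})
      = (\<Sum>(b, c)\<in>directions. card {a. a ^ 2 \<noteq> N c b})"
    by (subst card_SigmaI) (auto intro: sum.cong)
  ultimately have "card (SIGMA (b, c):directions. {a. a ^ 2 \<noteq> N c b}) \<le> (\<Sum>p\<in>directions. CARD('a) - 1)"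
    by simp
  also have "\<dots> = (CARD('a) + 1) * (CARD('a) - 1)"
    by (simp add: card_directions)
  also have "\<dots> = CARD('a) ^ 2 - 1"
    by (cases "CARD('a)") (auto simp: power2_eq_square)
  finally show ?thesis
    unfolding hyperbolic_lines_def by (intro order_trans[OF card_image_le]) auto
qed

text \<open>One of the two points of the quadric represented by a hyperbolic point has \<open>w \<noteq> 0\<close>.\<close>

lemma exists_lift:
  assumes "(y, z) \<in> hyperbolic_points"
  shows "\<exists>p. \<forall>l. coeff_vec l $ 1 = coeff_vec l $ 4 \<longrightarrow>
    coeff_vec l $ 2 * y + coeff_vec l $ 3 * z + coeff_vec l $ 4 = 0 \<longrightarrow>
    scalar_product (coeff_vec l) (quadric_point \<gamma> p) = 0"
proof -
  obtain t where t: "N y z = t ^ 2 + t"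
    using assms by (auto simp: hyperbolic_points_def artin_schreier_def)
  \<comment> \<open>The candidates are \<open>x = t\<close> and \<open>x = t + 1\<close>. A nonzero
    \<open>w\<close> allows division by it, which gives a point of the form
    \<open>Some\<close>.\<close>
  obtain x where x: "N y z = x * (x + 1)" "x + 1 \<noteq> 0"
  proof (cases "t + 1 = 0")
    case True
    then show ?thesis using that[of 0] t by (simp add: power2_eq_square add_eq_0)
  next
    case False
    then show ?thesis using that[of t] t by (simp add: power2_eq_square algebra_simps)
  qed
  define w where "w = x + 1"
  have w: "w \<noteq> 0" "x + w = 1" using x by (simp_all add: w_def flip: add.assoc)
  have Nw: "N (y / w) (z / w) = x / w"
  proof -
    have "N (y / w) (z / w) = N y z / w ^ 2"
      using w by (simp add: norm_form_def field_simps power2_eq_square)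
    also have "\<dots> = x / w"
      using w x(1) by (simp add: w_def[symmetric] power2_eq_square)
    finally show ?thesis .
  qed
  have "scalar_product (coeff_vec l) (quadric_point \<gamma> (Some (y / w, z / w))) = 0"
    if l: "coeff_vec l $ 1 = coeff_vec l $ 4"
      "coeff_vec l $ 2 * y + coeff_vec l $ 3 * z + coeff_vec l $ 4 = 0" for l
  proof -
    have "scalar_product (coeff_vec l) (quadric_point \<gamma> (Some (y / w, z / w)))
        = (coeff_vec l $ 2 * y + coeff_vec l $ 3 * z + coeff_vec l $ 4 * (x + w)) / w"
      using w(1) l(1) by (simp add: scalar_product_4 Nw field_simps)
    then show ?thesis using l(2) w(2) by simp
  qed
  then show ?thesis by blast
qed

text \<open>If the coefficients of \<open>y\<close> and \<open>z\<close> both vanish, the form is a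
  multiple of \<open>x + w\<close> and cuts out the base circle; otherwise scaling brings them to a
  normalised direction.\<close>

lemma hyperbolic_line_points:
  assumes l: "defines_hyperbolic_line \<gamma> l"
  shows "coeff_vec l $ 1 = coeff_vec l $ 4"
    and "\<exists>L\<in>hyperbolic_lines. \<forall>(y, z)\<in>L.
      coeff_vec l $ 2 * y + coeff_vec l $ 3 * z + coeff_vec l $ 4 = 0"
proof -
  have deg: "homogeneous_of_degree 1 l" and nt: "\<not> plane_tangent_to_quadric \<gamma> l" and "l \<noteq> 0"
    and not_base: "inversive_curve \<gamma> l \<noteq> base_circle \<gamma>"
    using l by (auto simp: defines_circle_def defines_hyperbolic_line_def)
  then have nz: "coeff_vec l \<noteq> 0"
    using coeff_vec_eq_0_iff by blast
  show sym: "coeff_vec l $ 1 = coeff_vec l $ 4"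
    using l xw_symmetric_coeff_vec by (auto simp: defines_hyperbolic_line_def)
  define A B C where "A = coeff_vec l $ 4" and "B = coeff_vec l $ 2" and "C = coeff_vec l $ 3"
  note co = A_def[symmetric] B_def[symmetric] C_def[symmetric]
  have "B \<noteq> 0 \<or> C \<noteq> 0"
  proof (rule ccontr)
    assume "\<not> (B \<noteq> 0 \<or> C \<noteq> 0)"
    then have BC: "B = 0" "C = 0" by auto
    have A: "A \<noteq> 0"
      using nz BC sym by (auto simp: vec4_eq_iff co)
    have "eval_at (Var 1 + Var 4) Q = Q $ 1 + Q $ 4" for Q :: "'a point"
    proof -
      have keys: "Poly_Mapping.keys (Var 1 + Var 4 :: 'a pol)
          \<subseteq> {Poly_Mapping.single 1 1, Poly_Mapping.single 4 1}"
        using keys_add[of "Var 1 :: 'a pol" "Var 4"] by (auto simp: Var_def split: if_splits)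
      then have "homogeneous_of_degree 1 (Var 1 + Var 4 :: 'a pol)"
        by (auto simp: homogeneous_of_degree_def sum_4 lookup_single simp del: One_nat_def)
      moreover have "coeff_vec (Var 1 + Var 4 :: 'a pol) = vec4 1 0 0 1"
      proof -
        have "Poly_Mapping.single i (1::nat) = Poly_Mapping.single j 1 \<longleftrightarrow> i = j" for i j :: 4
          by (metis lookup_single_eq lookup_single_not_eq zero_neq_one)
        then show ?thesis
          by (simp add: vec4_eq_iff coeff_vec_def Var_def lookup_add lookup_single del: One_nat_def)
      qed
      ultimately show ?thesis by (simp add: eval_at_linear_form scalar_product_4)
    qed
    moreover have "eval_at l Q = to_ac A * (Q $ 1 + Q $ 4)" for Q
      using BC sym by (simp add: eval_at_linear_form[OF deg] scalar_product_4 co algebra_simps)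
    ultimately have "surface l = surface (Var 1 + Var 4)"
      using A by (simp add: surface_def)
    then show False
      using not_base by (simp add: base_circle_def inversive_curve_def)
  qed
  then obtain r b c where r: "r \<noteq> 0" "(b, c) \<in> directions" "B = r * b" "C = r * c"
    using normalise_direction by blast
  define a where "a = A / r"
  have A: "A = r * a" using r by (simp add: a_def)
  have "a ^ 2 \<noteq> N c b"
  proof
    assume a2: "a ^ 2 = N c b"
    \<comment> \<open>In characteristic 2 the gradient of the quadric at this point is
      \<open>(a, b, c, a)\<close>, proportional to \<open>l\<close>, and
      \<open>a ^ 2 = N c b\<close> puts the point on the quadric.\<close>
    let ?P = "rational (vec4 a c b a)"
    have bc: "b \<noteq> 0 \<or> c \<noteq> 0" using r(2) directions_nonzero by blast
    have two_ac: "(2 :: 'a alg_closure) = 0"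
      using two_eq_0 to_ac_numeral[of "num.Bit0 num.One", where 'a = 'a] by simp
    have "eval_at (quadric_form \<gamma>) ?P = to_ac (a ^ 2 - N c b)"
      by (simp add: eval_at_quadric_form norm_form_def power2_eq_square algebra_simps)
    then have P: "?P \<in> quadric \<gamma>"
      using a2 bc by (auto simp: quadric_def surface_def vec4_eq_iff)
    have neg_ac: "- to_ac x = to_ac x" for x :: 'a
      by (metis neg_eq to_ac_minus)
    have "to_ac (coeff_vec l $ i) = to_ac r * gradient (quadric_form \<gamma>) ?P $ i" for i
    proof -
      have "\<forall>i. to_ac (coeff_vec l $ i) = to_ac r * gradient (quadric_form \<gamma>) ?P $ i"
        unfolding forall_4 gradient_quadric_form sym
        by (simp add: co A r two_ac neg_ac)
      then show ?thesis ..
    qed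
    then show False
      using plane_tangent_to_quadricI[OF deg P _ _ nz, of "to_ac r"] r(1) nt by simp
  qed
  then have "hyperbolic_line b c a \<in> hyperbolic_lines"
    unfolding hyperbolic_lines_def using r(2) by (intro image_eqI[of _ _ "((b, c), a)"]) auto
  moreover have "B * y + C * z + A = 0" if "(y, z) \<in> hyperbolic_line b c a" for y z
  proof -
    have "B * y + C * z + A = r * (b * y + c * z + a)"
      by (simp add: A r algebra_simps)
    then show ?thesis using that by (simp add: hyperbolic_line_def affine_line_def)
  qed
  ultimately show "\<exists>L\<in>hyperbolic_lines. \<forall>(y, z)\<in>L.
      coeff_vec l $ 2 * y + coeff_vec l $ 3 * z + coeff_vec l $ 4 = 0"
    unfolding co by (intro bexI) auto
qed

end

theorem line_transverse_free_exists:
  fixes \<gamma> :: "'a::finite_field" and q d :: nat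
  assumes q: "q = CARD('a)"
    and \<gamma>: "Factorial_Ring.irreducible [:\<gamma>, 1, 1:]"
    and "even q"
    and d: "real d > -3 + sqrt (12 * real q ^ 2 - 12 * real q + 1
                     - 24 * root (q div 2)
                         (real ((q * (q - 1) div 2) choose (q div 2)) * fact (q div 2)
                            / (real q ^ 2 - 1)))"
  shows "\<exists>f :: 'a pol. xw_symmetric f \<and> homogeneous_of_degree d f
                \<and> \<not> quadric_form \<gamma> dvd f \<and> line_transverse_free \<gamma> f"
proof -
  interpret elliptic_quadric_char_2 \<gamma>
    using no_root_of_irreducible[OF \<gamma>] \<open>even q\<close> by unfold_locales (auto simp: q)
  obtain k where k: "q = 2 * k" using \<open>even q\<close> by blast
  have k1: "k \<ge> 1" using card_gt_1[where 'a = 'a] q k by simp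
  define n where "n = k * (2 * k - 1)"
  have n: "card hyperbolic_points = n"
    using card_hyperbolic_points by (simp add: n_def k flip: q)
  define r where "r = root k (real (n choose k) * fact k / (real q ^ 2 - 1))"
  have n': "q * (q - 1) div 2 = n" "q div 2 = k"
    by (simp_all add: n_def k)
  have "12 * real q ^ 2 - 12 * real q + 1 - 24 * r < (real d + 3) ^ 2"
    using d unfolding n' r_def[symmetric] by (intro less_power2_if_sqrt_less) linarith
  moreover have "24 * real n = 12 * real q ^ 2 - 12 * real q"
    using k1 by (simp add: n_def k of_nat_diff power2_eq_square algebra_simps)
  ultimately have d': "(real d + 3) ^ 2 > 24 * (real n - r) + 1" by (simp add: algebra_simps)
  obtain m where m: "m \<le> n" "(q^2 - 1) * (m choose k) < n choose k"
    "6 * (n - m) < (d + 1) * (d + 2)"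
    using hyperbolic_line_count_estimate[OF k1 r_def[unfolded n_def k] d'[unfolded n_def]]
    unfolding n_def k by blast
  have lines: "L \<subseteq> hyperbolic_points \<and> card L = k" if "L \<in> hyperbolic_lines" for L
  proof -
    obtain b c a where "(b, c) \<in> directions" "a ^ 2 \<noteq> N c b" "L = hyperbolic_line b c a"
      using \<open>L \<in> hyperbolic_lines\<close> unfolding hyperbolic_lines_def by (elim imageE) auto
    then show ?thesis
      using card_hyperbolic_line[of b c a] k q by (auto simp: hyperbolic_line_def)
  qed
  have "card hyperbolic_lines * (m choose k) \<le> (q^2 - 1) * (m choose k)"
    using card_hyperbolic_lines by (intro mult_right_mono) (auto simp: q)
  then have "card hyperbolic_lines * (m choose k) < card hyperbolic_points choose k"
    unfolding n using m(2) by (rule le_less_trans)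
  then obtain S where S: "S \<subseteq> hyperbolic_points" "card S = n - m"
    "\<And>L. L \<in> hyperbolic_lines \<Longrightarrow> L \<inter> S \<noteq> {}"
    using exists_blocking_set[of hyperbolic_points hyperbolic_lines k m] m(1) lines n by auto
  have "\<forall>s\<in>S. \<exists>p. \<forall>l. coeff_vec l $ 1 = coeff_vec l $ 4 \<longrightarrow>
      coeff_vec l $ 2 * fst s + coeff_vec l $ 3 * snd s + coeff_vec l $ 4 = 0 \<longrightarrow>
      scalar_product (coeff_vec l) (quadric_point \<gamma> p) = 0"
    using S(1) by (auto intro!: exists_lift)
  from bchoice[OF this] obtain lift where lift: "\<forall>s\<in>S. \<forall>l. coeff_vec l $ 1 = coeff_vec l $ 4 \<longrightarrow>
      coeff_vec l $ 2 * fst s + coeff_vec l $ 3 * snd s + coeff_vec l $ 4 = 0 \<longrightarrow>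
      scalar_product (coeff_vec l) (quadric_point \<gamma> (lift s)) = 0" ..
  let ?\<rho> = "\<lambda>m. (Poly_Mapping.lookup m 2, Poly_Mapping.lookup m (3::4))"
  have "card (lift ` S) \<le> n - m"
    using card_image_le[of S lift] S(2) by simp
  then have card_less: "3 * card (lift ` S) < card (SIGMA j:{..d}. {..d - j})"
    using m(3) card_triangle[of d] by linarith
  obtain c where c: "reduced_pol ?\<rho> d c \<noteq> (0 :: 'a pol)"
    "\<And>p. p \<in> lift ` S \<Longrightarrow> one_jet \<gamma> (reduced_pol ?\<rho> d c :: 'a pol) p = 0"
    using exists_singular_reduced_pol[OF _ _ card_less triangle_index_surj, of \<gamma>] by auto
  have "circle_tangent_to \<gamma> l (reduced_pol ?\<rho> d c)" if l: "defines_hyperbolic_line \<gamma> l" for l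
  proof -
    obtain L where "L \<in> hyperbolic_lines"
      "\<forall>(y, z)\<in>L. coeff_vec l $ 2 * y + coeff_vec l $ 3 * z + coeff_vec l $ 4 = 0"
      using hyperbolic_line_points(2)[OF l] by blast
    then obtain s where "s \<in> S"
      "coeff_vec l $ 2 * fst s + coeff_vec l $ 3 * snd s + coeff_vec l $ 4 = 0"
      using S(3) by fastforce
    then have "scalar_product (coeff_vec l) (quadric_point \<gamma> (lift s)) = 0"
      using lift hyperbolic_line_points(1)[OF l] \<open>s \<in> S\<close> by blast
    then show ?thesis
      using l \<open>s \<in> S\<close>
      by (intro circle_tangent_toI[OF homogeneous_reduced_pol c(2)])
        (auto simp: defines_hyperbolic_line_def defines_circle_def)
  qed
  then show ?thesis
    using c(1) quadric_form_not_dvd_reduced[OF xw_reduced_reduced_pol] homogeneous_reduced_pol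
      xw_symmetric_reduced_pol
    unfolding line_transverse_free_def by blast
qed

theorem theorem1p3:
  fixes \<gamma> :: "'a::finite_field" and q :: nat
  assumes q: "q = CARD('a)"
    and \<gamma>: "Factorial_Ring.irreducible [:\<gamma>, 1, 1:]"
  shows
    "(\<forall>d::nat.
        real d > -1 + sqrt (3 * (real q ^ 2 + 1
                     - root (q + 1) (real ((q ^ 2) choose q) * fact (q - 1))))
        \<longrightarrow> (\<exists>f :: 'a pol. homogeneous_of_degree d f \<and> \<not> quadric_form \<gamma> dvd f
              \<and> circle_transverse_free \<gamma> f))
     \<and> (even q \<longrightarrow>
        (\<forall>d::nat.
          real d > -3 + sqrt (12 * real q ^ 2 - 12 * real q + 1
                     - 24 * root (q div 2)
                         (real ((q * (q - 1) div 2) choose (q div 2)) * fact (q div 2)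
                            / (real q ^ 2 - 1)))
          \<longrightarrow> (\<exists>f :: 'a pol. xw_symmetric f \<and> homogeneous_of_degree d f
                \<and> \<not> quadric_form \<gamma> dvd f \<and> line_transverse_free \<gamma> f)))"
  using circle_transverse_free_exists[OF q \<gamma>] line_transverse_free_exists[OF q \<gamma>] by blast

end
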